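(* The density of any TS-packing of at least three congruent spherical caps in $\mathbb{S}^2$ is strictly less than $\frac{\pi}{4}$.
   Context: $\mathbb{S}^2$ is the unit sphere centered at the origin in Euclidean $3$-space. A great circle is the intersection of $\mathbb{S}^2$ with a plane through the origin. The (closed) spherical cap of center $\mathbf{x}\in\mathbb{S}^2$ and angular radius $r\in(0,\frac{\pi}{2}]$ is $\{\mathbf{y}\in\mathbb{S}^2:\langle\mathbf{y},\mathbf{x}\rangle\ge\cos r\}$. A totally separable packing (TS-packing) of $\mathbb{S}^2$ is a (finite) family of spherical caps such that any two of its caps can be separated by a great circle (i.e. they lie in different closed hemispheres bounded by it) which is disjoint from the interior of each cap in the family. The density of a TS-packing of $m$ spherical caps of angular radius $\rho$ is the total spherical area of the caps divided by the area of $\mathbb{S}^2$, i.e. $\frac{1-\cos\rho}{2}\,m$. (For comparison, by a theorem of G. Fejes Tóth and L. Fejes Tóth, $\frac{\pi}{4}$ is the largest density of totally separable packings of congruent disks in the Euclidean plane.) *)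

theory Defs
  imports "HOL-Analysis.Analysis"
begin

abbreviation S2 :: "(real^3) set" where
  "S2 \<equiv> sphere 0 1"

text \<open>A plane through the origin is given by a nonzero normal vector \<open>u\<close>. The closed
  hemispheres bounded by \<open>great_circle u\<close> are \<open>hemisphere u\<close> and \<open>hemisphere (- u)\<close>.\<close>

definition great_circle :: "real^3 \<Rightarrow> (real^3) set" where
  "great_circle u = S2 \<inter> {y. u \<bullet> y = 0}"

definition hemisphere :: "real^3 \<Rightarrow> (real^3) set" where
  "hemisphere u = S2 \<inter> {y. u \<bullet> y \<ge> 0}"

definition cap :: "real^3 \<Rightarrow> real \<Rightarrow> (real^3) set" where
  "cap x r = {y \<in> S2. y \<bullet> x \<ge> cos r}"

text \<open>The caps form a family indexed by \<open>I\<close>, with centers \<open>x i\<close> and angular radii \<open>r i\<close>.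
  The interior of a cap is taken relative to the sphere, since in the ambient space it
  would be empty.\<close>

definition ts_packing :: "'i set \<Rightarrow> ('i \<Rightarrow> real^3) \<Rightarrow> ('i \<Rightarrow> real) \<Rightarrow> bool" where
  "ts_packing I x r \<longleftrightarrow>
     finite I \<and>
     (\<forall>i\<in>I. x i \<in> S2 \<and> r i \<in> {0<..pi/2}) \<and>
     (\<forall>i\<in>I. \<forall>j\<in>I. i \<noteq> j \<longrightarrow>
        (\<exists>u. u \<noteq> 0 \<and>
             cap (x i) (r i) \<subseteq> hemisphere u \<and>
             cap (x j) (r j) \<subseteq> hemisphere (- u) \<and>
             (\<forall>k\<in>I. great_circle u \<inter> (top_of_set S2 interior_of cap (x k) (r k)) = {})))"

text \<open>Surface measure on the sphere as the cone measure: by integration in polar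
  coordinates, the cone over \<open>A\<close> with apex the origin has volume one third of the area
  of \<open>A\<close>.\<close>

definition spherical_area :: "(real^3) set \<Rightarrow> real" where
  "spherical_area A = 3 * measure lebesgue {t *\<^sub>R y | t y. 0 \<le> t \<and> t \<le> 1 \<and> y \<in> A}"

definition packing_density :: "'i set \<Rightarrow> ('i \<Rightarrow> real^3) \<Rightarrow> ('i \<Rightarrow> real) \<Rightarrow> real" where
  "packing_density I x r = (\<Sum>i\<in>I. spherical_area (cap (x i) (r i))) / spherical_area S2"

end

theory Submission
  imports Defs
begin

text \<open>
  Let \<open>m \<ge> 3\<close> congruent caps of radius \<open>\<rho>\<close> form a TS-packing. Split the sphere along the
  separating great circles one at a time, but let each circle cut only the cell in which two
  caps still have to be separated. In the end there are \<open>m\<close> convex cells with one cap each.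
  A cut creates two new sides, and at most two of the old sides are needed on both sides of it
  (\<open>cell_cut\<close>), so each cut raises the total number of sides by at most four. Since the first
  circle yields two hemispheres with one side each, the final cells have at most \<open>4 m - 6\<close>
  sides altogether (\<open>volume_cell_ge\<close>, \<open>ts_packing_volume_bound\<close>).

  Every circle used stays at angular distance at least \<open>\<rho>\<close> from every center, because it misses
  the interiors of the caps. Let \<open>\<rho>\<^sub>0 \<le> \<rho>\<close> and \<open>R > \<rho>\<^sub>0\<close>. A cell with \<open>k\<close> sides around a center
  covers the concentric cap of radius \<open>R\<close>, apart from at most \<open>k\<close> segments of that cap, each cut
  off by a great circle at distance \<open>\<rho>\<^sub>0\<close> or more (\<open>volume_cell_single_cap\<close>). As the cells are
  disjoint, \<open>m\<close> times the area of the cap minus \<open>4 m - 6\<close> times the area of the segment is at most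
  \<open>4 \<pi>\<close>. With \<open>2 \<phi>\<close> the angle under which the segment is seen from the center, \<open>c = cos \<rho>\<^sub>0\<close> and
  \<open>q = cos R = c cos \<phi> / sqrt (1 - (c sin \<phi>)\<^sup>2)\<close>, these areas are \<open>2 \<pi> (1 - q)\<close> and
  \<open>2 arcsin (c sin \<phi>) - 2 q \<phi>\<close> (\<open>volume_cap_wedge_closed_form\<close>, where all areas appear as
  volumes of cones in the unit ball).

  The best choice is \<open>\<phi> = \<pi> m / (4 m - 6)\<close>: then \<open>R\<close> is the circumradius of a regular polygon with
  \<open>4 - 6 / m\<close> sides, the average number, and the terms with \<open>q\<close> cancel. With
  \<open>s = \<pi> / (4 m - 6)\<close> what remains is \<open>sin (\<pi> / 4 - s / 2) \<le> c sin (\<pi> / 4 + 3 s / 2)\<close>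
  (\<open>ts_packing_angle_bound\<close>). A density of at least \<open>\<pi> / 4\<close> would permit
  \<open>c = 1 - \<pi> / (2 m)\<close>, but for this value the inequality fails (\<open>density_threshold\<close>). This last
  point is a strict estimate for all \<open>m \<ge> 3\<close>; in the limit \<open>m \<longrightarrow> \<infinity>\<close> it becomes an equality,
  which is the planar density of the square lattice of disks.
\<close>

section \<open>Cutting a cell by a great circle\<close>

text \<open>
  Cells are solid: the part of the unit ball in an open polyhedral cone. Its volume is a third of
  the area of the spherical polygon. Strict inequalities make the two halves of a cut disjoint.
\<close>
definition open_cell :: "(real^3) set \<Rightarrow> (real^3) set" where
  "open_cell N = {p \<in> cball 0 1. \<forall>u\<in>N. 0 < u \<bullet> p}"

text \<open>The vectors \<open>z\<close> and \<open>v \<times> z\<close> form an orthogonal basis of the plane with normal \<open>v\<close>.\<close>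
lemma orthogonal_plane_expansion:
  fixes v z y :: "real^3"
  assumes "v \<bullet> z = 0" "v \<bullet> y = 0"
  defines "e \<equiv> cross3 v z"
  shows "(e \<bullet> e) *\<^sub>R y = (e \<bullet> y) *\<^sub>R e + ((y \<bullet> z) * (v \<bullet> v)) *\<^sub>R z"
proof -
  have "cross3 e (cross3 y e) = (e \<bullet> e) *\<^sub>R y - (e \<bullet> y) *\<^sub>R e"
    by (rule Lagrange)
  moreover have "cross3 y e = (y \<bullet> z) *\<^sub>R v"
    using assms(2) by (simp add: e_def Lagrange inner_commute)
  moreover have "cross3 e v = (v \<bullet> v) *\<^sub>R z"
    using assms(1) unfolding e_def by (subst cross_skew) (simp add: Lagrange)
  ultimately show ?thesis
    by (simp add: cross_mult_right)
qed

lemma finite_ne_obtain_max: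
  fixes f :: "'a \<Rightarrow> real"
  assumes "finite N" "N \<noteq> {}"
  obtains a where "a \<in> N" "\<And>u. u \<in> N \<Longrightarrow> f u \<le> f a"
proof -
  have "Max (f ` N) \<in> f ` N" using assms by (intro Max_in) auto
  then obtain a where "a \<in> N" "Max (f ` N) = f a" by auto
  then show thesis using that assms(1) by (metis Max_ge finite_imageI imageI)
qed

text \<open>
  A cell meets the plane of the cutting circle in a planar convex cone, and such a cone is bounded
  by at most two rays. In the basis \<open>z\<close>, \<open>v \<times> z\<close>, with \<open>z\<close> inside the cone, the two rays belong to
  the constraints of extreme slope.
\<close>
lemma two_constraints_suffice_on_plane:
  fixes v z :: "real^3"
  assumes "finite N" "N \<noteq> {}" "v \<noteq> 0" "v \<bullet> z = 0" and pos: "\<And>u. u \<in> N \<Longrightarrow> 0 < u \<bullet> z"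
  obtains a b where "a \<in> N" "b \<in> N"
    "\<And>y w. v \<bullet> y = 0 \<Longrightarrow> 0 < a \<bullet> y \<Longrightarrow> 0 < b \<bullet> y \<Longrightarrow> w \<in> N \<Longrightarrow> 0 < w \<bullet> y"
proof -
  define e where "e = cross3 v z"
  define t where "t u = (u \<bullet> e) / (u \<bullet> z)" for u
  obtain a where a: "a \<in> N" "\<And>u. u \<in> N \<Longrightarrow> t u \<le> t a"
    using finite_ne_obtain_max[OF assms(1,2), of t] by blast
  obtain b where b: "b \<in> N" "\<And>u. u \<in> N \<Longrightarrow> t b \<le> t u"
    using finite_ne_obtain_max[OF assms(1,2), of "\<lambda>u. - t u"] by auto
  show thesis
  proof (rule that[OF a(1) b(1)])
    fix y w assume y: "v \<bullet> y = 0" "0 < a \<bullet> y" "0 < b \<bullet> y" and w: "w \<in> N"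
    have "z \<noteq> 0" using pos[OF a(1)] by auto
    then have "e \<noteq> 0"
      using assms(3,4) norm_and_cross_eq_0[of v z] by (auto simp: e_def)
    then have e: "0 < e \<bullet> e" by simp
    define p q where "p = e \<bullet> y" and "q = (y \<bullet> z) * (v \<bullet> v)"
    have form: "(e \<bullet> e) * (u \<bullet> y) = (u \<bullet> z) * (p * t u + q)" if "u \<in> N" for u
    proof -
      have "u \<bullet> ((e \<bullet> e) *\<^sub>R y) = u \<bullet> (p *\<^sub>R e + q *\<^sub>R z)"
        using orthogonal_plane_expansion[OF assms(4) y(1)] by (simp add: e_def p_def q_def)
      then show ?thesis
        using pos[OF that] by (simp add: inner_add_right t_def field_simps)
    qed
    have pos_iff: "0 < u \<bullet> y \<longleftrightarrow> 0 < p * t u + q" if "u \<in> N" for u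
    proof -
      have "0 < u \<bullet> y \<longleftrightarrow> 0 < (e \<bullet> e) * (u \<bullet> y)"
        using e zero_less_mult_iff[of "e \<bullet> e" "u \<bullet> y"] by linarith
      then show ?thesis
        unfolding form[OF that]
        using pos[OF that] zero_less_mult_iff[of "u \<bullet> z" "p * t u + q"] by linarith
    qed
    have "min (p * t b) (p * t a) \<le> p * t w"
      using mult_left_mono[OF b(2)[OF w], of p] mult_left_mono_neg[OF a(2)[OF w], of p]
      by (cases "0 \<le> p") linarith+
    then show "0 < w \<bullet> y"
      using pos_iff[OF a(1)] pos_iff[OF b(1)] pos_iff[OF w] y by linarith
  qed
qed

text \<open>
  The counting step: only two constraints \<open>a\<close> and \<open>b\<close> survive in both halves. If another \<open>w\<close> were
  violated by points \<open>p\<close> and \<open>q\<close> on either side of the cut that both satisfy \<open>a\<close> and \<open>b\<close>, then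
  \<open>w\<close> would be violated where the segment from \<open>p\<close> to \<open>q\<close> crosses the plane, although on the plane
  \<open>a\<close> and \<open>b\<close> imply \<open>w\<close>. So in one of the halves \<open>w\<close> follows from \<open>a\<close>, \<open>b\<close> and the cut itself.
\<close>
lemma cell_cut:
  fixes v z :: "real^3"
  assumes "finite N" "N \<noteq> {}" "v \<noteq> 0" "v \<bullet> z = 0" and pos: "\<And>u. u \<in> N \<Longrightarrow> 0 < u \<bullet> z"
  obtains N1 N2 where "N1 \<subseteq> N" "N2 \<subseteq> N" "card N1 + card N2 \<le> card N + 2"
    "open_cell (insert v N1) = open_cell (insert v N)"
    "open_cell (insert (-v) N2) = open_cell (insert (-v) N)"
proof -
  obtain a b where ab: "a \<in> N" "b \<in> N"
    and suff: "\<And>y w. v \<bullet> y = 0 \<Longrightarrow> 0 < a \<bullet> y \<Longrightarrow> 0 < b \<bullet> y \<Longrightarrow> w \<in> N \<Longrightarrow> 0 < w \<bullet> y"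
    using two_constraints_suffice_on_plane[OF assms(1-4) pos] by blast
  define implied where "implied v' w \<longleftrightarrow> (\<forall>p. 0 < v' \<bullet> p \<longrightarrow> 0 < a \<bullet> p \<longrightarrow> 0 < b \<bullet> p \<longrightarrow> 0 < w \<bullet> p)"
    for v' w :: "real^3"
  have one_side: "implied v w \<or> implied (-v) w" if w: "w \<in> N" for w
  proof (rule ccontr)
    assume "\<not> ?thesis"
    then obtain p q where p: "0 < v \<bullet> p" "0 < a \<bullet> p" "0 < b \<bullet> p" "w \<bullet> p \<le> 0"
      and q: "v \<bullet> q < 0" "0 < a \<bullet> q" "0 < b \<bullet> q" "w \<bullet> q \<le> 0"
      by (auto simp: implied_def not_less)
    \<comment> \<open>a positive multiple of the point where the segment from \<open>p\<close> to \<open>q\<close> meets the plane\<close>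
    define y where "y = (- (v \<bullet> q)) *\<^sub>R p + (v \<bullet> p) *\<^sub>R q"
    have "v \<bullet> y = 0" by (simp add: y_def inner_add_right inner_diff_right)
    moreover have "0 < a \<bullet> y" "0 < b \<bullet> y"
      unfolding y_def inner_add_right inner_scaleR_right using p q
      by (intro add_pos_pos mult_pos_pos; simp)+
    ultimately have "0 < w \<bullet> y" using suff w by blast
    moreover have "w \<bullet> y \<le> 0"
      unfolding y_def inner_add_right inner_scaleR_right using p q
      by (intro add_nonpos_nonpos mult_nonneg_nonpos) auto
    ultimately show False by simp
  qed
  define N1 where "N1 = {a, b} \<union> {w \<in> N - {a, b}. \<not> implied v w}"
  define N2 where "N2 = {a, b} \<union> {w \<in> N - {a, b}. implied v w}"
  have sub: "N1 \<subseteq> N" "N2 \<subseteq> N" using ab by (auto simp: N1_def N2_def)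
  have fin: "finite N1" "finite N2" using sub assms(1) finite_subset by auto
  have "N1 \<union> N2 = N" "N1 \<inter> N2 = {a, b}" using ab by (auto simp: N1_def N2_def)
  then have "card N1 + card N2 = card N + card {a, b}"
    using card_Un_Int[OF fin] by simp
  moreover have "card {a, b} \<le> 2" by (cases "a = b") auto
  ultimately have "card N1 + card N2 \<le> card N + 2" by linarith
  moreover have "0 < w \<bullet> p" if "w \<in> N" "0 < v \<bullet> p" "\<forall>u\<in>N1. 0 < u \<bullet> p" for w p
    using that by (cases "implied v w") (auto simp: N1_def implied_def)
  then have "open_cell (insert v N1) = open_cell (insert v N)"
    unfolding open_cell_def using sub by auto
  moreover have "0 < w \<bullet> p" if "w \<in> N" "0 < (-v) \<bullet> p" "\<forall>u\<in>N2. 0 < u \<bullet> p" for w p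
  proof (cases "w \<in> N2")
    case False
    then have "implied (-v) w" using one_side[OF that(1)] that(1) by (auto simp: N2_def)
    then show ?thesis using that(2,3) unfolding implied_def by (auto simp: N2_def)
  qed (use that in auto)
  then have "open_cell (insert (-v) N2) = open_cell (insert (-v) N)"
    unfolding open_cell_def using sub by auto
  ultimately show thesis using that sub by blast
qed

lemma open_cell_measurable [measurable]: "finite N \<Longrightarrow> open_cell N \<in> sets borel"
proof -
  assume "finite N"
  have "open_cell N = cball 0 1 \<inter> (\<Inter>u\<in>N. {p. 0 < u \<bullet> p})" by (auto simp: open_cell_def)
  moreover have "open (\<Inter>u\<in>N. {p. 0 < u \<bullet> p})"
    using \<open>finite N\<close> by (intro open_INT) (auto intro: open_halfspace_gt simp: open_Collect_less)
  ultimately show ?thesis by auto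
qed

lemma bounded_lmeasurable:
  fixes S :: "(real^3) set"
  assumes "S \<in> sets borel" "S \<subseteq> cball 0 1"
  shows "S \<in> lmeasurable"
proof (rule bounded_set_imp_lmeasurable)
  show "bounded S" using assms(2) bounded_cball bounded_subset by blast
  show "S \<in> sets lebesgue" using assms(1) by simp
qed

lemma open_cell_lmeasurable: "finite N \<Longrightarrow> open_cell N \<in> lmeasurable"
  by (intro bounded_lmeasurable open_cell_measurable) (auto simp: open_cell_def)

lemma volume_cell_cut:
  assumes "finite N"
  shows "measure lebesgue (open_cell (insert v N)) + measure lebesgue (open_cell (insert (-v) N))
    \<le> measure lebesgue (open_cell N)"
proof -
  have disjoint: "open_cell (insert v N) \<inter> open_cell (insert (-v) N) = {}"
    by (auto simp: open_cell_def)
  have "measure lebesgue (open_cell (insert v N)) + measure lebesgue (open_cell (insert (-v) N))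
     = measure lebesgue (open_cell (insert v N) \<union> open_cell (insert (-v) N))"
    using measure_Un3[of "open_cell (insert v N)" lebesgue "open_cell (insert (-v) N)"] assms
    by (simp add: open_cell_lmeasurable disjoint)
  also have "\<dots> \<le> measure lebesgue (open_cell N)"
    by (intro measure_mono_fmeasurable fmeasurableD fmeasurable.Un open_cell_lmeasurable)
      (auto simp: open_cell_def assms)
  finally show ?thesis .
qed

text \<open>
  Induction on the number of caps in a cell. If \<open>A - k B\<close> bounds the volume of a cell with \<open>k\<close> sides
  that contains one cap, then a cell with several caps is cut by a circle separating two of them.
  The bound is stable under this because a cut adds one cell and at most four sides.
\<close>
lemma volume_cell_ge:
  fixes A B s :: real and x :: "'i \<Rightarrow> real^3"
  assumes B: "0 \<le> B" and "0 < s"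
    and single: "\<And>i N. i \<in> I \<Longrightarrow> finite N \<Longrightarrow> (\<And>u. u \<in> N \<Longrightarrow> norm u = 1 \<and> s \<le> u \<bullet> x i)
      \<Longrightarrow> A - card N * B \<le> measure lebesgue (open_cell N)"
    and sep: "\<And>i j. i \<in> I \<Longrightarrow> j \<in> I \<Longrightarrow> i \<noteq> j \<Longrightarrow>
      \<exists>v. norm v = 1 \<and> s \<le> v \<bullet> x i \<and> v \<bullet> x j \<le> - s \<and> (\<forall>k\<in>I. s \<le> \<bar>v \<bullet> x k\<bar>)"
  shows "finite S \<Longrightarrow> S \<noteq> {} \<Longrightarrow> S \<subseteq> I \<Longrightarrow> finite N \<Longrightarrow> N \<noteq> {} \<Longrightarrow>
     (\<And>u i. u \<in> N \<Longrightarrow> i \<in> S \<Longrightarrow> norm u = 1 \<and> s \<le> u \<bullet> x i) \<Longrightarrow>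
     card S * A - (card N + 4 * real (card S) - 4) * B \<le> measure lebesgue (open_cell N)"
proof (induction "card S" arbitrary: S N rule: less_induct)
  case less
  show ?case
  proof (cases "card S = 1")
    case True
    then obtain i where "S = {i}" by (meson card_1_singletonE)
    then show ?thesis using single[of i N] less.prems True by simp
  next
    case False
    then obtain i j where ij: "i \<in> S" "j \<in> S" "i \<noteq> j"
      using less.prems(1,2) by (metis is_singletonI' is_singleton_altdef)
    then obtain v where v: "norm v = 1" "s \<le> v \<bullet> x i" "v \<bullet> x j \<le> - s" "\<And>k. k \<in> I \<Longrightarrow> s \<le> \<bar>v \<bullet> x k\<bar>"
      using sep[of i j] less.prems(3) by blast
    \<comment> \<open>a point of the cutting plane inside the cell, on the segment joining the two centers\<close>
    define z where "z = (- (v \<bullet> x j)) *\<^sub>R x i + (v \<bullet> x i) *\<^sub>R x j"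
    have "v \<noteq> 0" using v(1) by auto
    moreover have "v \<bullet> z = 0" by (simp add: z_def inner_add_right inner_diff_right)
    moreover have "0 < u \<bullet> z" if "u \<in> N" for u
    proof -
      have "0 < u \<bullet> x i" "0 < u \<bullet> x j" using less.prems(6)[OF that] ij \<open>0 < s\<close> by force+
      then show ?thesis unfolding z_def inner_add_right inner_scaleR_right using v(2,3) \<open>0 < s\<close>
        by (intro add_pos_pos mult_pos_pos) auto
    qed
    ultimately obtain N1 N2 where N12: "N1 \<subseteq> N" "N2 \<subseteq> N" "card N1 + card N2 \<le> card N + 2"
      and cells: "open_cell (insert v N1) = open_cell (insert v N)"
        "open_cell (insert (-v) N2) = open_cell (insert (-v) N)"
      using cell_cut[of N v z] less.prems(4,5) by metis
    have fin: "finite N1" "finite N2" using N12(1,2) less.prems(4) finite_subset by auto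
    define S1 S2 where "S1 = {k \<in> S. 0 < v \<bullet> x k}" and "S2 = {k \<in> S. \<not> 0 < v \<bullet> x k}"
    have S: "finite S1" "finite S2" "i \<in> S1" "j \<in> S2" "S1 \<subseteq> S" "S2 \<subseteq> S" "card S1 + card S2 = card S"
    proof -
      show "finite S1" "finite S2" using less.prems(1) by (auto simp: S1_def S2_def)
      show "i \<in> S1" "j \<in> S2" "S1 \<subseteq> S" "S2 \<subseteq> S" using ij v \<open>0 < s\<close> by (auto simp: S1_def S2_def)
      have "S1 \<union> S2 = S" "S1 \<inter> S2 = {}" by (auto simp: S1_def S2_def)
      then show "card S1 + card S2 = card S" using card_Un_disjoint \<open>finite S1\<close> \<open>finite S2\<close> by metis
    qed
    then have "0 < card S1" "0 < card S2" using card_gt_0_iff by blast+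
    then have lt: "card S1 < card S" "card S2 < card S" using S(7) by auto
    have "card S1 * A - (card (insert v N1) + 4 * real (card S1) - 4) * B \<le> measure lebesgue (open_cell (insert v N1))"
    proof (rule less.hyps[OF lt(1)])
      show "norm u = 1 \<and> s \<le> u \<bullet> x k" if "u \<in> insert v N1" "k \<in> S1" for u k
        using that less.prems(3,6) N12(1) v(1) v(4)[of k] by (fastforce simp: S1_def)
    qed (use S fin less.prems(3) in auto)
    moreover have "card S2 * A - (card (insert (-v) N2) + 4 * real (card S2) - 4) * B \<le> measure lebesgue (open_cell (insert (-v) N2))"
    proof (rule less.hyps[OF lt(2)])
      show "norm u = 1 \<and> s \<le> u \<bullet> x k" if "u \<in> insert (-v) N2" "k \<in> S2" for u k
        using that less.prems(3,6) N12(2) v(1) v(4)[of k] by (fastforce simp: S2_def)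
    qed (use S fin less.prems(3) in auto)
    moreover have "(real (card (insert v N1)) + 4 * card S1 - 4 + (real (card (insert (-v) N2)) + 4 * card S2 - 4)) * B
       \<le> (card N + 4 * real (card S) - 4) * B"
    proof (rule mult_right_mono[OF _ B])
      have "card (insert v N1) \<le> Suc (card N1)" "card (insert (-v) N2) \<le> Suc (card N2)"
        using fin by (auto simp: card_insert_if)
      then have "card (insert v N1) + card (insert (-v) N2) \<le> card N + 4"
        using N12(3) by linarith
      moreover have "real (card S) = real (card S1) + real (card S2)"
        using S(7) by linarith
      ultimately show "real (card (insert v N1)) + 4 * card S1 - 4 + (real (card (insert (-v) N2)) + 4 * card S2 - 4)
         \<le> card N + 4 * real (card S) - 4"
        by linarith
    qed
    moreover have "card S * A = card S1 * A + card S2 * A"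
      using S(7) by (metis distrib_right of_nat_add)
    ultimately show ?thesis
      using volume_cell_cut[OF less.prems(4), of v] unfolding cells by (simp add: algebra_simps)
  qed
qed

section \<open>Volume in gnomonic coordinates\<close>

text \<open>
  The coordinate along the axis of the cone comes first, so that the iterated integral over
  \<open>coords c a b\<close> has the height \<open>c\<close> outermost.
\<close>
definition coords :: "real \<Rightarrow> real \<Rightarrow> real \<Rightarrow> real^3" where
  "coords c a b = a *\<^sub>R axis 1 1 + b *\<^sub>R axis 2 1 + c *\<^sub>R axis 3 1"

lemma coords_nth [simp]: "coords c a b $ 1 = a" "coords c a b $ 2 = b" "coords c a b $ 3 = c"
  by (simp_all add: coords_def axis_def)

lemma coords_measurable: "(\<lambda>(c, a, b). coords c a b) \<in> borel_measurable borel"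
  unfolding coords_def case_prod_beta
  by (intro borel_measurable_continuous_onI continuous_intros)

lemma Basis_triple: "(Basis :: (real \<times> real \<times> real) set) = {(1, 0, 0), (0, 1, 0), (0, 0, 1)}"
    by (auto simp: Basis_prod_def zero_prod_def)

lemma emeasure_box_triple:
  fixes l1 l2 l3 u1 u2 u3 :: real
  assumes "l1 \<le> u1" "l2 \<le> u2" "l3 \<le> u3"
  shows "emeasure lborel (box (l1, l2, l3) (u1, u2, u3)) = ennreal ((u1 - l1) * ((u2 - l2) * (u3 - l3)))"
proof -
    have "emeasure lborel (box (l1, l2, l3) (u1, u2, u3))
        = (\<Prod>b\<in>Basis. ((u1, u2, u3) - (l1, l2, l3)) \<bullet> b)"
      by (rule emeasure_lborel_box) (use assms in \<open>auto simp: Basis_triple\<close>)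
    also have "\<dots> = (\<Prod>b\<in>{(1, 0, 0), (0, 1, 0), (0, 0, 1)}. ((u1, u2, u3) - (l1, l2, l3)) \<bullet> b)"
      by (simp only: Basis_triple)
    also have "\<dots> = ennreal ((u1 - l1) * ((u2 - l2) * (u3 - l3)))"
      by simp
    finally show ?thesis .
qed
text \<open>
  Fubini's theorem is available for products, so Lebesgue measure on \<open>real^3\<close> is identified with
  the one on triples. Both measures agree on boxes.
\<close>
lemma distr_coords: "distr lborel borel (\<lambda>(c, a, b). coords c a b) = (lborel :: (real^3) measure)"
proof (rule lborel_eqI[symmetric])
  fix l u :: "real^3"
  assume le: "\<And>b. b \<in> Basis \<Longrightarrow> l \<bullet> b \<le> u \<bullet> b"
  have le': "l $ i \<le> u $ i" for i
    using le[of "axis i 1"] by (simp add: inner_axis axis_in_Basis_iff)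
  have "(\<lambda>(c, a, b). coords c a b) -` box l u
      = box (l $ 3, l $ 1, l $ 2) (u $ 3, u $ 1, u $ 2)"
    by (auto simp: mem_box_cart forall_3 mem_box Basis_triple)
  then have "emeasure (distr lborel borel (\<lambda>(c, a, b). coords c a b)) (box l u)
      = emeasure lborel (box (l $ 3, l $ 1, l $ 2) (u $ 3, u $ 1, u $ 2))"
    by (simp add: emeasure_distr coords_measurable)
  also have "\<dots> = ennreal ((u $ 3 - l $ 3) * ((u $ 1 - l $ 1) * (u $ 2 - l $ 2)))"
    by (rule emeasure_box_triple; rule le')
  also have "(u $ 3 - l $ 3) * ((u $ 1 - l $ 1) * (u $ 2 - l $ 2)) = (\<Prod>b\<in>Basis. (u - l) \<bullet> b)"
  proof -
    have basis: "(Basis :: (real^3) set) = {axis 3 1, axis 1 1, axis 2 1}"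
      by (auto simp: Basis_vec_def) (metis exhaust_3)
    have "axis 3 1 \<notin> {axis 1 1, axis 2 1 :: real^3}" "axis 1 1 \<notin> {axis 2 1 :: real^3}"
      by (auto simp: axis_eq_axis)
    then show ?thesis unfolding basis by (simp add: inner_axis)
  qed
  finally show "emeasure (distr lborel borel (\<lambda>(c, a, b). coords c a b)) (box l u) = (\<Prod>b\<in>Basis. (u - l) \<bullet> b)" .
qed simp

lemma nn_integral_coords:
  assumes [measurable]: "f \<in> borel_measurable borel"
  shows "(\<integral>\<^sup>+p. f p \<partial>(lborel :: (real^3) measure)) = (\<integral>\<^sup>+c. \<integral>\<^sup>+a. \<integral>\<^sup>+b. f (coords c a b) \<partial>lborel \<partial>lborel \<partial>lborel)"
proof -
  define g where "g q = f (case q of (c, a, b) \<Rightarrow> coords c a b)" for q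
  have g: "g \<in> borel_measurable (borel :: (real \<times> real \<times> real) measure)"
    unfolding g_def by (rule measurable_compose[OF coords_measurable assms])
  have "(\<integral>\<^sup>+p. f p \<partial>(lborel :: (real^3) measure)) = (\<integral>\<^sup>+p. f p \<partial>distr lborel borel (\<lambda>(c, a, b). coords c a b))"
    by (simp only: distr_coords)
  also have "\<dots> = (\<integral>\<^sup>+q. g q \<partial>lborel)"
    unfolding g_def by (rule nn_integral_distr) (simp_all add: coords_measurable assms)
  also have "\<dots> = (\<integral>\<^sup>+q. g q \<partial>(lborel \<Otimes>\<^sub>M (lborel :: (real \<times> real) measure)))"
    by (simp only: lborel_prod)
  also have "\<dots> = (\<integral>\<^sup>+c. \<integral>\<^sup>+q. g (c, q) \<partial>lborel \<partial>lborel)"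
    by (rule lborel.nn_integral_fst[symmetric]) (simp only: lborel_prod measurable_lborel2 g)
  also have "\<dots> = (\<integral>\<^sup>+c. \<integral>\<^sup>+a. \<integral>\<^sup>+b. f (coords c a b) \<partial>lborel \<partial>lborel \<partial>lborel)"
  proof (rule nn_integral_cong)
    fix c :: real
    have gc: "(\<lambda>q. g (c, q)) \<in> borel_measurable (borel :: (real \<times> real) measure)"
      by (rule measurable_compose[OF _ g]) (intro borel_measurable_continuous_onI continuous_intros)
    have "(\<integral>\<^sup>+q. g (c, q) \<partial>lborel) = (\<integral>\<^sup>+q. g (c, q) \<partial>(lborel \<Otimes>\<^sub>M (lborel :: real measure)))"
      by (simp only: lborel_prod)
    also have "\<dots> = (\<integral>\<^sup>+a. \<integral>\<^sup>+b. g (c, a, b) \<partial>lborel \<partial>lborel)"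
      by (rule lborel.nn_integral_fst[symmetric]) (simp only: lborel_prod measurable_lborel2 gc)
    finally show "(\<integral>\<^sup>+q. g (c, q) \<partial>lborel) = (\<integral>\<^sup>+a. \<integral>\<^sup>+b. f (coords c a b) \<partial>lborel \<partial>lborel)"
      by (simp add: g_def)
  qed
  finally show ?thesis .
qed

text \<open>
  For orthonormal \<open>x\<close> and \<open>w\<close>: the cone over the part of the cap with center \<open>x\<close> and radius
  \<open>arctan T\<close> that lies beyond the great circle at distance \<open>arctan t\<close> from \<open>x\<close> in the direction of
  \<open>w\<close>. In the gnomonic projection it is the segment \<open>t \<le> a\<close> of the disk \<open>a\<^sup>2 + b\<^sup>2 \<le> T\<^sup>2\<close>.
\<close>
definition cap_wedge :: "real^3 \<Rightarrow> real^3 \<Rightarrow> real \<Rightarrow> real \<Rightarrow> (real^3) set" where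
  "cap_wedge x w t T =
     {p \<in> cball 0 1. 0 < x \<bullet> p \<and> t * (x \<bullet> p) \<le> w \<bullet> p \<and> (norm p)\<^sup>2 \<le> (1 + T\<^sup>2) * (x \<bullet> p)\<^sup>2}"

lemma cap_wedge_borel [measurable]: "cap_wedge x w t T \<in> sets borel"
  unfolding cap_wedge_def by measurable

text \<open>
  An antiderivative of \<open>sqrt (T\<^sup>2 - a\<^sup>2) / (1 + a\<^sup>2)\<close>. Written with \<open>arcsin\<close> instead of the more usual
  \<open>arctan (a sqrt (1 + T\<^sup>2) / sqrt (T\<^sup>2 - a\<^sup>2))\<close>, it is continuous up to the ends \<open>a = T\<close> and
  \<open>a = - T\<close>, which the fundamental theorem of calculus requires.
\<close>
definition segment_primitive :: "real \<Rightarrow> real \<Rightarrow> real" where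
  "segment_primitive T a = sqrt (1 + T\<^sup>2) * arcsin (a * sqrt (1 + T\<^sup>2) / (T * sqrt (1 + a\<^sup>2))) - arcsin (a / T)"

lemma segment_primitive_arg_bound:
  fixes a T :: real
  assumes "0 < T" "\<bar>a\<bar> \<le> T"
  shows "\<bar>a * sqrt (1 + T\<^sup>2) / (T * sqrt (1 + a\<^sup>2))\<bar> \<le> 1"
proof -
  have "a\<^sup>2 \<le> T\<^sup>2" using assms by (metis abs_le_square_iff abs_of_pos)
  then have "a\<^sup>2 * (1 + T\<^sup>2) \<le> T\<^sup>2 * (1 + a\<^sup>2)" by (simp add: algebra_simps)
  then have "sqrt (a\<^sup>2 * (1 + T\<^sup>2)) \<le> sqrt (T\<^sup>2 * (1 + a\<^sup>2))" by simp
  then have "\<bar>a\<bar> * sqrt (1 + T\<^sup>2) \<le> T * sqrt (1 + a\<^sup>2)"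
    using assms by (simp add: real_sqrt_mult)
  moreover have "0 < T * sqrt (1 + a\<^sup>2)" using assms by (simp add: add_pos_nonneg)
  ultimately show ?thesis using assms(1) by (simp add: abs_mult)
qed

lemma segment_primitive_deriv:
  assumes "0 < T" "\<bar>a\<bar> < T"
  shows "(segment_primitive T has_real_derivative sqrt (T\<^sup>2 - a\<^sup>2) / (1 + a\<^sup>2)) (at a)"
proof -
  define S where "S = sqrt (1 + T\<^sup>2)"
  define g where "g = sqrt (1 + a\<^sup>2)"
  define h where "h = sqrt (T\<^sup>2 - a\<^sup>2)"
  have "a\<^sup>2 < T\<^sup>2" using power_strict_mono[OF assms(2) abs_ge_zero, of 2] by simp
  then have pos: "0 < S" "0 < g" "0 < h" and sq: "S\<^sup>2 = 1 + T\<^sup>2" "g\<^sup>2 = 1 + a\<^sup>2" "h\<^sup>2 = T\<^sup>2 - a\<^sup>2"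
    by (simp_all add: S_def g_def h_def add_pos_nonneg)
  define y where "y = a * S / (T * g)"
  have y2: "1 - y\<^sup>2 = (h / (T * g))\<^sup>2"
  proof -
    have "(T * g)\<^sup>2 - (a * S)\<^sup>2 = h\<^sup>2"
      by (simp add: power_mult_distrib sq algebra_simps)
    moreover have "1 - (a * S)\<^sup>2 / (T * g)\<^sup>2 = ((T * g)\<^sup>2 - (a * S)\<^sup>2) / (T * g)\<^sup>2"
      by (subst diff_divide_distrib) (use assms(1) pos in simp)
    ultimately show ?thesis
      unfolding y_def power_divide by simp
  qed
  have "0 < 1 - y\<^sup>2" unfolding y2 using pos assms(1) by simp
  then have y: "-1 < y" "y < 1" using abs_square_less_1[of y] by auto
  have sq_y: "sqrt (1 - y\<^sup>2) = h / (T * g)" using y2 pos assms(1) by simp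
  have "((\<lambda>a. sqrt (1 + a\<^sup>2)) has_real_derivative a / g) (at a)"
    using pos(2) unfolding g_def by (auto intro!: derivative_eq_intros simp: field_simps)
  then have "((\<lambda>a. a * S / (T * sqrt (1 + a\<^sup>2))) has_real_derivative
      (S * (T * g) - a * S * (T * (a / g))) / ((T * g) * (T * g))) (at a)"
    unfolding g_def using assms(1) pos(2)
    by (intro DERIV_divide DERIV_cmult) (auto intro!: derivative_eq_intros simp: g_def)
  moreover have "(S * (T * g) - a * S * (T * (a / g))) / ((T * g) * (T * g)) = S / (T * g ^ 3)"
  proof -
    have "S * (T * g) - a * S * (T * (a / g)) = S * T * (g\<^sup>2 - a\<^sup>2) / g"
      using pos(2) by (simp add: field_simps power2_eq_square)
    also have "\<dots> = S * T / g" by (simp add: sq)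
    finally show ?thesis using assms(1) pos(2) by (simp add: field_simps power3_eq_cube)
  qed
  ultimately have "((\<lambda>a. a * S / (T * sqrt (1 + a\<^sup>2))) has_real_derivative S / (T * g ^ 3)) (at a)"
    by simp
  then have d1: "((\<lambda>a. arcsin (a * S / (T * sqrt (1 + a\<^sup>2)))) has_real_derivative
      inverse (sqrt (1 - y\<^sup>2)) * (S / (T * g ^ 3))) (at a)"
    by (rule DERIV_chain2[where f = arcsin, rotated])
      (use DERIV_arcsin[OF y] in \<open>simp add: y_def g_def\<close>)
  have at: "-1 < a / T" "a / T < 1" using assms by (auto simp: field_simps abs_less_iff)
  have "1 - (a / T)\<^sup>2 = (h / T)\<^sup>2"
    using assms(1) by (simp add: power_divide sq field_simps)
  then have sq_a: "sqrt (1 - (a / T)\<^sup>2) = h / T" using pos assms(1) by simp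
  have "((\<lambda>a. a / T) has_real_derivative 1 / T) (at a)"
    using assms(1) by (auto intro!: derivative_eq_intros)
  then have d2: "((\<lambda>a. arcsin (a / T)) has_real_derivative inverse (sqrt (1 - (a / T)\<^sup>2)) * (1 / T)) (at a)"
    by (rule DERIV_chain2[where f = arcsin, rotated]) (rule DERIV_arcsin[OF at])
  have "(segment_primitive T has_real_derivative
      S * (inverse (sqrt (1 - y\<^sup>2)) * (S / (T * g ^ 3))) - inverse (sqrt (1 - (a / T)\<^sup>2)) * (1 / T)) (at a)"
    unfolding segment_primitive_def S_def[symmetric] by (intro DERIV_diff DERIV_cmult d1 d2)
  moreover have "S * (inverse (sqrt (1 - y\<^sup>2)) * (S / (T * g ^ 3))) - inverse (sqrt (1 - (a / T)\<^sup>2)) * (1 / T)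
      = h / g\<^sup>2"
  proof -
    have "S * (inverse (sqrt (1 - y\<^sup>2)) * (S / (T * g ^ 3))) - inverse (sqrt (1 - (a / T)\<^sup>2)) * (1 / T)
        = S\<^sup>2 / (h * g\<^sup>2) - 1 / h"
      unfolding sq_y sq_a using assms(1) pos by (simp add: power2_eq_square power3_eq_cube)
    also have "\<dots> = (S\<^sup>2 - g\<^sup>2) / (h * g\<^sup>2)"
      using pos by (simp add: field_simps)
    also have "S\<^sup>2 - g\<^sup>2 = h * h"
      by (simp add: sq power2_eq_square[symmetric])
    finally show ?thesis using pos by simp
  qed
  ultimately show ?thesis by (simp add: h_def sq)
qed

lemma segment_primitive_ends:
  assumes "0 < T"
  shows "segment_primitive T T = (sqrt (1 + T\<^sup>2) - 1) * (pi / 2)"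
    and "segment_primitive T (- T) = - ((sqrt (1 + T\<^sup>2) - 1) * (pi / 2))"
proof -
  have "0 < sqrt (1 + T\<^sup>2)" by (simp add: add_pos_nonneg)
  then have "T * sqrt (1 + T\<^sup>2) / (T * sqrt (1 + T\<^sup>2)) = 1" "T / T = 1"
    using assms by simp_all
  then show "segment_primitive T T = (sqrt (1 + T\<^sup>2) - 1) * (pi / 2)"
    "segment_primitive T (- T) = - ((sqrt (1 + T\<^sup>2) - 1) * (pi / 2))"
    unfolding segment_primitive_def power2_minus minus_mult_left[symmetric] minus_divide_left[symmetric]
    by (simp_all only: arcsin_1 arcsin_minus_1, simp_all add: field_simps)
qed

lemma segment_integral:
  assumes "0 < T" "- T \<le> t" "t \<le> T"
  shows "((\<lambda>a. sqrt (T\<^sup>2 - a\<^sup>2) / (1 + a\<^sup>2)) has_integral (segment_primitive T T - segment_primitive T t)) {t..T}"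
proof (rule fundamental_theorem_of_calculus_interior[OF assms(3)])
  have "\<forall>a\<in>{t..T}. T * sqrt (1 + a\<^sup>2) \<noteq> 0"
    using assms(1) by (simp add: add_pos_nonneg less_imp_neq[symmetric])
  moreover have "\<forall>a\<in>{t..T}. - 1 \<le> a * sqrt (1 + T\<^sup>2) / (T * sqrt (1 + a\<^sup>2)) \<and> a * sqrt (1 + T\<^sup>2) / (T * sqrt (1 + a\<^sup>2)) \<le> 1"
  proof
    fix a assume "a \<in> {t..T}"
    then have "\<bar>a\<bar> \<le> T" using assms by auto
    from segment_primitive_arg_bound[OF assms(1) this]
    show "- 1 \<le> a * sqrt (1 + T\<^sup>2) / (T * sqrt (1 + a\<^sup>2)) \<and> a * sqrt (1 + T\<^sup>2) / (T * sqrt (1 + a\<^sup>2)) \<le> 1"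
      by linarith
  qed
  moreover have "\<forall>a\<in>{t..T}. - 1 \<le> a / T \<and> a / T \<le> 1"
    using assms by (auto simp: field_simps)
  ultimately show "continuous_on {t..T} (segment_primitive T)"
    unfolding segment_primitive_def using assms(1)
    by (intro continuous_on_diff continuous_on_mult continuous_on_const continuous_on_arcsin
        continuous_on_divide continuous_on_id continuous_on_real_sqrt continuous_on_add continuous_on_power)
      blast+
  show "(segment_primitive T has_vector_derivative sqrt (T\<^sup>2 - a\<^sup>2) / (1 + a\<^sup>2)) (at a)" if "a \<in> {t<..<T}" for a
    unfolding has_real_derivative_iff_has_vector_derivative[symmetric]
    by (rule segment_primitive_deriv[OF assms(1)]) (use that assms in auto)
qed

text \<open>The volume per unit area of the gnomonic plane, integrated along a ray, with \<open>k = 1 + a\<^sup>2 + b\<^sup>2\<close>.\<close>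
lemma nn_integral_ray:
  fixes k :: real
  assumes "0 < k"
  shows "(\<integral>\<^sup>+c. ennreal (if 0 < c \<and> c\<^sup>2 * k \<le> 1 then c\<^sup>2 else 0) \<partial>lborel) = ennreal (1 / (3 * sqrt k ^ 3))"
proof -
  define r where "r = 1 / sqrt k"
  have r: "0 < r" using assms by (simp add: r_def)
  have iff: "c\<^sup>2 * k \<le> 1 \<longleftrightarrow> c \<le> r" if "0 < c" for c
  proof -
    have "c\<^sup>2 * k \<le> 1 \<longleftrightarrow> (c * sqrt k)\<^sup>2 \<le> 1\<^sup>2" using assms by (simp add: power_mult_distrib)
    also have "\<dots> \<longleftrightarrow> c * sqrt k \<le> 1" using that assms by (subst power2_le_iff_abs_le) auto
    finally show ?thesis using assms by (simp add: r_def field_simps)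
  qed
  have "(\<integral>\<^sup>+c. ennreal (if 0 < c \<and> c\<^sup>2 * k \<le> 1 then c\<^sup>2 else 0) \<partial>lborel)
      = (\<integral>\<^sup>+c. ennreal (c\<^sup>2) * indicator {0..r} c \<partial>lborel)"
    using iff by (intro nn_integral_cong) (auto simp: indicator_def)
  also have "\<dots> = ennreal (r ^ 3 / 3 - 0 ^ 3 / 3)"
    using r by (intro nn_integral_FTC_Icc) (auto intro!: derivative_eq_intros)
  also have "r ^ 3 / 3 - 0 ^ 3 / 3 = 1 / (3 * sqrt k ^ 3)" by (simp add: r_def power_divide)
  finally show ?thesis .
qed

text \<open>Integration over the chord of the disk of radius \<open>T\<close> at distance \<open>a\<close> from its center.\<close>
lemma nn_integral_chord:
  fixes a T :: real
  assumes "0 < T" "\<bar>a\<bar> \<le> T"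
  shows "(\<integral>\<^sup>+b. ennreal (if a\<^sup>2 + b\<^sup>2 \<le> T\<^sup>2 then 1 / (3 * sqrt (1 + a\<^sup>2 + b\<^sup>2) ^ 3) else 0) \<partial>lborel)
    = ennreal (2 / (3 * sqrt (1 + T\<^sup>2)) * (sqrt (T\<^sup>2 - a\<^sup>2) / (1 + a\<^sup>2)))"
proof -
  define B where "B = sqrt (T\<^sup>2 - a\<^sup>2)"
  have "a\<^sup>2 \<le> T\<^sup>2" using assms by (metis abs_le_square_iff abs_of_pos)
  then have B: "0 \<le> B" "B\<^sup>2 = T\<^sup>2 - a\<^sup>2" by (auto simp: B_def)
  define F where "F b = b / (3 * (1 + a\<^sup>2) * sqrt (1 + a\<^sup>2 + b\<^sup>2))" for b
  have pa: "0 < 1 + a\<^sup>2" by (simp add: add_pos_nonneg)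
  have pk: "0 < 1 + a\<^sup>2 + b\<^sup>2" for b using pa by (simp add: add_pos_nonneg)
  have F: "(F has_real_derivative 1 / (3 * sqrt (1 + a\<^sup>2 + b\<^sup>2) ^ 3)) (at b)" for b
  proof -
    define g where "g = sqrt (1 + a\<^sup>2 + b\<^sup>2)"
    have g: "0 < g" "g\<^sup>2 = 1 + a\<^sup>2 + b\<^sup>2" using pk[of b] by (auto simp: g_def)
    have "((\<lambda>b. sqrt (1 + a\<^sup>2 + b\<^sup>2)) has_real_derivative b / g) (at b)"
      using pk[of b] unfolding g_def by (auto intro!: derivative_eq_intros simp: field_simps)
    then have "(F has_real_derivative (1 * (3 * (1 + a\<^sup>2) * g) - b * (3 * (1 + a\<^sup>2) * (b / g)))
        / ((3 * (1 + a\<^sup>2) * g) * (3 * (1 + a\<^sup>2) * g))) (at b)"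
      unfolding F_def[abs_def] g_def using g(1) pa
      by (intro DERIV_divide DERIV_cmult) (auto intro!: derivative_eq_intros simp: g_def)
    moreover have "(1 * (3 * (1 + a\<^sup>2) * g) - b * (3 * (1 + a\<^sup>2) * (b / g))) / ((3 * (1 + a\<^sup>2) * g) * (3 * (1 + a\<^sup>2) * g))
       = 1 / (3 * g ^ 3)"
    proof -
      have "1 * (3 * (1 + a\<^sup>2) * g) - b * (3 * (1 + a\<^sup>2) * (b / g)) = 3 * (1 + a\<^sup>2) * (g\<^sup>2 - b\<^sup>2) / g"
        using g(1) by (simp add: field_simps power2_eq_square)
      also have "g\<^sup>2 - b\<^sup>2 = 1 + a\<^sup>2" by (simp add: g)
      finally have num: "1 * (3 * (1 + a\<^sup>2) * g) - b * (3 * (1 + a\<^sup>2) * (b / g)) = 3 * (1 + a\<^sup>2) * (1 + a\<^sup>2) / g" .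
      have "3 * k * k / g / ((3 * k * g) * (3 * k * g)) = 1 / (3 * g ^ 3)" if "0 < k" for k
        using that g(1) by (simp add: power3_eq_cube)
      from this[OF pa] show ?thesis unfolding num .
    qed
    ultimately show ?thesis by (simp add: g_def)
  qed
  have "(\<integral>\<^sup>+b. ennreal (if a\<^sup>2 + b\<^sup>2 \<le> T\<^sup>2 then 1 / (3 * sqrt (1 + a\<^sup>2 + b\<^sup>2) ^ 3) else 0) \<partial>lborel)
     = (\<integral>\<^sup>+b. ennreal (1 / (3 * sqrt (1 + a\<^sup>2 + b\<^sup>2) ^ 3)) * indicator {-B..B} b \<partial>lborel)"
  proof (rule nn_integral_cong)
    fix b :: real
    have "a\<^sup>2 + b\<^sup>2 \<le> T\<^sup>2 \<longleftrightarrow> b\<^sup>2 \<le> B\<^sup>2" using B(2) by linarith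
    also have "\<dots> \<longleftrightarrow> - B \<le> b \<and> b \<le> B" using B(1) power2_le_iff_abs_le[of B b] by (auto simp: abs_le_iff)
    finally show "ennreal (if a\<^sup>2 + b\<^sup>2 \<le> T\<^sup>2 then 1 / (3 * sqrt (1 + a\<^sup>2 + b\<^sup>2) ^ 3) else 0)
      = ennreal (1 / (3 * sqrt (1 + a\<^sup>2 + b\<^sup>2) ^ 3)) * indicator {-B..B} b"
      by (auto simp: indicator_def)
  qed
  also have "\<dots> = ennreal (F B - F (- B))"
    using B(1) pk by (intro nn_integral_FTC_Icc F) (auto intro: less_imp_le)
  also have "F B - F (- B) = 2 / (3 * sqrt (1 + T\<^sup>2)) * (B / (1 + a\<^sup>2))"
    using B(2) by (simp add: F_def)
  finally show ?thesis by (simp add: B_def)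
qed

text \<open>
  In the slice at height \<open>c\<close>, scaling both coordinates by \<open>c\<close> gives the factor \<open>c\<^sup>2\<close> and makes the
  cross-section of the cone independent of \<open>c\<close>. The function \<open>K\<close> is the resulting integrand; its
  integral is then evaluated in the order \<open>c\<close>, \<open>b\<close>, \<open>a\<close>.
\<close>
lemma emeasure_standard_wedge:
  assumes T: "0 < T" "- T \<le> t" "t \<le> T"
  shows "emeasure lborel (cap_wedge (axis 3 1) (axis 1 1) t T)
    = ennreal (2 / (3 * sqrt (1 + T\<^sup>2)) * (segment_primitive T T - segment_primitive T t))"
proof -
  let ?W = "cap_wedge (axis 3 1) (axis 1 1) t T"
  define K :: "real \<Rightarrow> real \<Rightarrow> real \<Rightarrow> real" where
    "K c a b = (if t \<le> a \<and> a\<^sup>2 + b\<^sup>2 \<le> T\<^sup>2 then if 0 < c \<and> c\<^sup>2 * (1 + a\<^sup>2 + b\<^sup>2) \<le> 1 then c\<^sup>2 else 0 else 0)" for c a b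
  have mem: "coords c a b \<in> ?W \<longleftrightarrow> 0 < c \<and> t * c \<le> a \<and> a\<^sup>2 + b\<^sup>2 \<le> T\<^sup>2 * c\<^sup>2 \<and> a\<^sup>2 + b\<^sup>2 + c\<^sup>2 \<le> 1" for c a b
  proof -
    have "(norm (coords c a b))\<^sup>2 = a\<^sup>2 + b\<^sup>2 + c\<^sup>2"
      unfolding power2_norm_eq_inner by (simp add: inner_vec_def sum_3 power2_eq_square)
    moreover have "norm (coords c a b) \<le> 1 \<longleftrightarrow> (norm (coords c a b))\<^sup>2 \<le> 1"
      by (simp add: power_le_one_iff)
    ultimately show ?thesis
      by (auto simp: cap_wedge_def inner_axis' algebra_simps)
  qed
  have scale: "(\<integral>\<^sup>+a. \<integral>\<^sup>+b. indicator ?W (coords c a b) \<partial>lborel \<partial>lborel)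
      = (\<integral>\<^sup>+a. \<integral>\<^sup>+b. ennreal (K c a b) \<partial>lborel \<partial>lborel)" for c
  proof (cases "0 < c")
    case True
    have [measurable]: "(\<lambda>(a, b). indicator ?W (coords c a b) :: ennreal) \<in> borel_measurable (lborel \<Otimes>\<^sub>M lborel)"
      unfolding coords_def by measurable
    have "(\<integral>\<^sup>+a. \<integral>\<^sup>+b. indicator ?W (coords c a b) \<partial>lborel \<partial>lborel)
       = ennreal c * (\<integral>\<^sup>+a. \<integral>\<^sup>+b. indicator ?W (coords c (c * a) b) \<partial>lborel \<partial>lborel)"
      using True by (subst nn_integral_real_affine[where c = c and t = 0]) auto
    also have "\<dots> = ennreal c * (\<integral>\<^sup>+a. ennreal c * (\<integral>\<^sup>+b. indicator ?W (coords c (c * a) (c * b)) \<partial>lborel) \<partial>lborel)"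
      using True
      by (intro arg_cong[where f = "\<lambda>x. ennreal c * x"] nn_integral_cong, subst nn_integral_real_affine[where c = c and t = 0])
        (auto simp: coords_def)
    also have "\<dots> = (\<integral>\<^sup>+a. \<integral>\<^sup>+b. ennreal c * (ennreal c * indicator ?W (coords c (c * a) (c * b))) \<partial>lborel \<partial>lborel)"
      by (simp add: nn_integral_cmult coords_def)
    also have "\<dots> = (\<integral>\<^sup>+a. \<integral>\<^sup>+b. ennreal (K c a b) \<partial>lborel \<partial>lborel)"
    proof (intro nn_integral_cong)
      fix a b :: real
      have "coords c (c * a) (c * b) \<in> ?W \<longleftrightarrow> t * c \<le> a * c \<and> c\<^sup>2 * (a\<^sup>2 + b\<^sup>2) \<le> c\<^sup>2 * T\<^sup>2 \<and> c\<^sup>2 * (1 + a\<^sup>2 + b\<^sup>2) \<le> 1"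
        unfolding mem using True by (auto simp: power_mult_distrib algebra_simps)
      also have "\<dots> \<longleftrightarrow> t \<le> a \<and> a\<^sup>2 + b\<^sup>2 \<le> T\<^sup>2 \<and> c\<^sup>2 * (1 + a\<^sup>2 + b\<^sup>2) \<le> 1"
        using True by (simp add: mult_le_cancel_right mult_le_cancel_left)
      finally show "ennreal c * (ennreal c * indicator ?W (coords c (c * a) (c * b))) = ennreal (K c a b)"
        using True by (auto simp: K_def indicator_def ennreal_mult[symmetric] power2_eq_square)
    qed
    finally show ?thesis .
  next
    case False
    then have "K c a b = 0" for a b by (simp add: K_def)
    with False show ?thesis by (simp add: mem indicator_def)
  qed
  have K_c: "(\<integral>\<^sup>+c. ennreal (K c a b) \<partial>lborel)
      = (if t \<le> a then ennreal (if a\<^sup>2 + b\<^sup>2 \<le> T\<^sup>2 then 1 / (3 * sqrt (1 + a\<^sup>2 + b\<^sup>2) ^ 3) else 0) else 0)" for a b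
  proof -
    have "0 < 1 + a\<^sup>2 + b\<^sup>2" by (simp add: add_pos_nonneg)
    then show ?thesis using nn_integral_ray[of "1 + a\<^sup>2 + b\<^sup>2"] by (simp add: K_def)
  qed
  have K_b: "(\<integral>\<^sup>+b. (if t \<le> a then ennreal (if a\<^sup>2 + b\<^sup>2 \<le> T\<^sup>2 then 1 / (3 * sqrt (1 + a\<^sup>2 + b\<^sup>2) ^ 3) else 0) else 0) \<partial>lborel)
      = ennreal (2 / (3 * sqrt (1 + T\<^sup>2)) * (sqrt (T\<^sup>2 - a\<^sup>2) / (1 + a\<^sup>2))) * indicator {t..T} a" for a
  proof -
    consider "a < t" | "t \<le> a" "a \<le> T" | "T < a" by linarith
    then show ?thesis
    proof cases
      case 2
      then show ?thesis using nn_integral_chord[of T a] T by (simp add: abs_le_iff)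
    next
      case 3
      then have "T\<^sup>2 < a\<^sup>2" using T(1) by (intro power_strict_mono) auto
      then have "\<not> a\<^sup>2 + b\<^sup>2 \<le> T\<^sup>2" for b by (smt (verit) zero_le_power2)
      moreover have "t \<le> a" using 3 T(3) by simp
      ultimately show ?thesis using 3 by simp
    qed simp
  qed
  have "emeasure lborel ?W = (\<integral>\<^sup>+p. indicator ?W p \<partial>lborel)" by simp
  also have "\<dots> = (\<integral>\<^sup>+c. \<integral>\<^sup>+a. \<integral>\<^sup>+b. indicator ?W (coords c a b) \<partial>lborel \<partial>lborel \<partial>lborel)"
    by (intro nn_integral_coords) simp
  also have "\<dots> = (\<integral>\<^sup>+c. \<integral>\<^sup>+a. \<integral>\<^sup>+b. ennreal (K c a b) \<partial>lborel \<partial>lborel \<partial>lborel)"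
    by (simp only: scale)
  also have "\<dots> = (\<integral>\<^sup>+a. \<integral>\<^sup>+c. \<integral>\<^sup>+b. ennreal (K c a b) \<partial>lborel \<partial>lborel \<partial>lborel)"
    by (rule lborel_pair.Fubini'[symmetric]) (simp add: K_def)
  also have "\<dots> = (\<integral>\<^sup>+a. \<integral>\<^sup>+b. \<integral>\<^sup>+c. ennreal (K c a b) \<partial>lborel \<partial>lborel \<partial>lborel)"
    by (intro nn_integral_cong lborel_pair.Fubini'[symmetric]) (simp add: K_def)
  also have "\<dots> = (\<integral>\<^sup>+a. ennreal (2 / (3 * sqrt (1 + T\<^sup>2)) * (sqrt (T\<^sup>2 - a\<^sup>2) / (1 + a\<^sup>2))) * indicator {t..T} a \<partial>lborel)"
    by (simp only: K_c K_b)
  also have "\<dots> = ennreal (2 / (3 * sqrt (1 + T\<^sup>2)) * (segment_primitive T T - segment_primitive T t))"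
  proof (rule nn_integral_has_integral_lebesgue')
    show "0 \<le> 2 / (3 * sqrt (1 + T\<^sup>2)) * (sqrt (T\<^sup>2 - a\<^sup>2) / (1 + a\<^sup>2))" if "a \<in> {t..T}" for a
    proof -
      have "a\<^sup>2 \<le> T\<^sup>2" using that T by (intro abs_le_square_iff[THEN iffD1]) auto
      then show ?thesis by simp
    qed
  qed (intro has_integral_mult_right segment_integral T)
  finally show ?thesis .
qed

lemma orthonormal_frame_rotation:
  fixes x w :: "real^3"
  assumes "norm x = 1" "norm w = 1" "x \<bullet> w = 0"
  obtains f :: "real^3 \<Rightarrow> real^3" where "orthogonal_transformation f" "f (axis 3 1) = x" "f (axis 1 1) = w"
proof -
  define e where "e = cross3 x w"
  define f where "f p = (p $ 1) *\<^sub>R w + (p $ 2) *\<^sub>R e + (p $ 3) *\<^sub>R x" for p :: "real^3"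
  have "(norm e)\<^sup>2 = 1" using norm_cross_dot[of x w] assms by (simp add: e_def)
  then have ip: "x \<bullet> x = 1" "w \<bullet> w = 1" "e \<bullet> e = 1" "x \<bullet> w = 0" "w \<bullet> x = 0" "e \<bullet> x = 0" "x \<bullet> e = 0" "e \<bullet> w = 0" "w \<bullet> e = 0"
    using assms dot_cross_self by (auto simp: e_def norm_eq_1 inner_commute power2_norm_eq_inner)
  have "linear f"
    by (rule linearI) (simp_all add: f_def algebra_simps)
  moreover have "f p \<bullet> f q = p \<bullet> q" for p q
  proof -
    have "f p \<bullet> f q = p $ 1 * q $ 1 + p $ 2 * q $ 2 + p $ 3 * q $ 3"
      by (simp add: f_def inner_add_left inner_add_right ip)
    then show ?thesis by (simp add: inner_vec_def sum_3)
  qed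
  ultimately have "orthogonal_transformation f" by (simp add: orthogonal_transformation_def)
  moreover have "f (axis 3 1) = x" "f (axis 1 1) = w" by (simp_all add: f_def axis_def)
  ultimately show thesis using that by blast
qed

lemma volume_cap_wedge:
  assumes "norm x = 1" "norm w = 1" "x \<bullet> w = 0" and T: "0 < T" "- T \<le> t" "t \<le> T"
  shows "measure lebesgue (cap_wedge x w t T)
    = 2 / (3 * sqrt (1 + T\<^sup>2)) * (segment_primitive T T - segment_primitive T t)"
proof -
  let ?W = "cap_wedge (axis 3 1) (axis 1 1) t T"
  obtain f :: "real^3 \<Rightarrow> real^3"
    where f: "orthogonal_transformation f" "f (axis 3 1) = x" "f (axis 1 1) = w"
    using orthonormal_frame_rotation[OF assms(1-3)] .
  have mem: "f p \<in> cap_wedge x w t T \<longleftrightarrow> p \<in> ?W" for p :: "real^3"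
    using f(1) unfolding f(2,3)[symmetric] cap_wedge_def
    by (simp add: orthogonal_transformation_def orthogonal_transformation_norm)
  have "cap_wedge x w t T = f ` ?W"
    using mem orthogonal_transformation_surj[OF f(1)] by (auto simp: image_iff) (metis surjD)
  moreover have "?W \<in> lmeasurable"
    by (intro bounded_set_imp_lmeasurable bounded_subset[OF bounded_cball[of 0 1]]) (auto simp: cap_wedge_def[of _ _ t T, symmetric], simp add: cap_wedge_def)
  ultimately have "measure lebesgue (cap_wedge x w t T) = measure lebesgue ?W"
    using measure_orthogonal_image[OF f(1)] by simp
  also have "\<dots> = measure lborel ?W" by simp
  also have "0 \<le> segment_primitive T T - segment_primitive T t"
  proof (rule has_integral_nonneg[OF segment_integral[OF T]])
    fix a assume "a \<in> {t..T}"
    then have "a\<^sup>2 \<le> T\<^sup>2" using T by (intro abs_le_square_iff[THEN iffD1]) auto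
    then show "0 \<le> sqrt (T\<^sup>2 - a\<^sup>2) / (1 + a\<^sup>2)" by simp
  qed
  then have "measure lborel ?W = 2 / (3 * sqrt (1 + T\<^sup>2)) * (segment_primitive T T - segment_primitive T t)"
    unfolding measure_def emeasure_standard_wedge[OF T] by simp
  finally show ?thesis .
qed

text \<open>
  With \<open>c = cos \<rho>\<^sub>0\<close> we have \<open>t = tan \<rho>\<^sub>0\<close>, and the chord seen under the angle \<open>2 \<phi>\<close> has
  \<open>T = tan \<rho>\<^sub>0 / cos \<phi>\<close>, so that \<open>q = 1 / sqrt (1 + T\<^sup>2) = cos R\<close>. The second formula is the case of
  the whole cap.
\<close>
lemma volume_cap_wedge_closed_form:
  assumes "norm x = 1" "norm w = 1" "x \<bullet> w = 0"
    and c: "0 < c" "c < 1" and \<phi>: "0 < \<phi>" "\<phi> < pi / 2"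
  defines "t \<equiv> sqrt (1 - c\<^sup>2) / c" and "q \<equiv> c * cos \<phi> / sqrt (1 - (c * sin \<phi>)\<^sup>2)"
  shows "measure lebesgue (cap_wedge x w t (t / cos \<phi>)) = 2 / 3 * (arcsin (c * sin \<phi>) - q * \<phi>)"
    and "measure lebesgue (cap_wedge x w (- (t / cos \<phi>)) (t / cos \<phi>)) = 2 * pi / 3 * (1 - q)"
proof -
  define T where "T = t / cos \<phi>"
  define S where "S = sqrt (1 + T\<^sup>2)"
  define d where "d = sqrt (1 - (c * sin \<phi>)\<^sup>2)"
  have cos: "0 < cos \<phi>" "cos \<phi> < 1" using \<phi> cos_gt_zero cos_monotone_0_pi[of 0 \<phi>] by auto
  have sin: "0 < sin \<phi>" "sin \<phi> \<le> 1" using \<phi> sin_gt_zero[of \<phi>] by auto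
  have "c * sin \<phi> \<le> c * 1" using c sin by (intro mult_left_mono) auto
  then have csin: "0 < c * sin \<phi>" "c * sin \<phi> < 1"
    using c mult_pos_pos[OF c(1) sin(1)] by linarith+
  have c2: "c\<^sup>2 < 1" using c by (simp add: power_less_one_iff)
  have d: "0 < d" "d\<^sup>2 = 1 - (c * sin \<phi>)\<^sup>2"
    using csin by (simp_all add: d_def power_less_one_iff less_imp_le)
  have t: "0 < t" "t\<^sup>2 = (1 - c\<^sup>2) / c\<^sup>2" using c c2 by (simp_all add: t_def power_divide)
  have T: "0 < T" "t \<le> T" using t cos by (simp_all add: T_def field_simps)
  have q: "0 < q" "q = c * cos \<phi> / d" using c cos d by (simp_all add: q_def d_def)
  have "1 + T\<^sup>2 = (1 / q)\<^sup>2"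
  proof -
    have "c\<^sup>2 * (cos \<phi>)\<^sup>2 + (1 - c\<^sup>2) = d\<^sup>2"
      unfolding d(2) by (simp add: power_mult_distrib sin_squared_eq algebra_simps)
    moreover have "1 + T\<^sup>2 = (c\<^sup>2 * (cos \<phi>)\<^sup>2 + (1 - c\<^sup>2)) / (c\<^sup>2 * (cos \<phi>)\<^sup>2)"
      using c cos by (simp add: T_def power_divide t(2) field_simps)
    ultimately show ?thesis by (simp add: q(2) power_divide power_mult_distrib)
  qed
  then have S: "S = 1 / q" unfolding S_def using q(1) by simp
  have "1 + t\<^sup>2 = (1 / c)\<^sup>2" using c by (simp add: t(2) power_divide field_simps)
  then have sqrt_t: "sqrt (1 + t\<^sup>2) = 1 / c" using c by simp
  note ends = segment_primitive_ends[OF T(1), folded S_def]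
  have "t * S / (T * sqrt (1 + t\<^sup>2)) = d"
    unfolding sqrt_t S q(2) T_def using t cos c d by (simp add: field_simps)
  moreover have "t / T = cos \<phi>" using t cos by (simp add: T_def)
  moreover have "arcsin d = pi / 2 - arcsin (c * sin \<phi>)"
  proof -
    have "d = cos (arcsin (c * sin \<phi>))"
      using csin by (simp add: d_def cos_arcsin)
    also have "\<dots> = sin (pi / 2 - arcsin (c * sin \<phi>))" by (simp add: sin_diff)
    finally show ?thesis
      using arcsin_bounded[of "c * sin \<phi>"] arcsin_le_arcsin[of 0 "c * sin \<phi>"] csin by (simp add: arcsin_sin)
  qed
  moreover have "arcsin (cos \<phi>) = pi / 2 - \<phi>"
    using arcsin_sin[of "pi / 2 - \<phi>"] \<phi> by (simp add: sin_diff)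
  ultimately have mid: "segment_primitive T t = S * (pi / 2 - arcsin (c * sin \<phi>)) - (pi / 2 - \<phi>)"
    by (simp add: segment_primitive_def S_def[symmetric])
  have "segment_primitive T T - segment_primitive T t = S * arcsin (c * sin \<phi>) - \<phi>"
    unfolding ends mid by (simp add: field_simps)
  then have "measure lebesgue (cap_wedge x w t T) = 2 / (3 * S) * (S * arcsin (c * sin \<phi>) - \<phi>)"
    using volume_cap_wedge[OF assms(1-3) T(1) _ T(2)] t(1) T(1) by (simp add: S_def)
  also have "\<dots> = 2 / 3 * (arcsin (c * sin \<phi>) - q * \<phi>)"
    unfolding S using q(1) by (simp add: field_simps)
  finally show "measure lebesgue (cap_wedge x w t (t / cos \<phi>)) = 2 / 3 * (arcsin (c * sin \<phi>) - q * \<phi>)"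
    by (simp add: T_def)
  have "segment_primitive T T - segment_primitive T (- T) = (S - 1) * pi"
    unfolding ends by (simp add: field_simps)
  then have "measure lebesgue (cap_wedge x w (- T) T) = 2 / (3 * S) * ((S - 1) * pi)"
    using volume_cap_wedge[OF assms(1-3) T(1), of "- T"] T(1) by (simp add: S_def)
  also have "\<dots> = 2 * pi / 3 * (1 - q)"
    unfolding S using q(1) by (simp add: field_simps)
  finally show "measure lebesgue (cap_wedge x w (- (t / cos \<phi>)) (t / cos \<phi>)) = 2 * pi / 3 * (1 - q)"
    by (simp add: T_def)
qed

text \<open>The cone over a cap, with its apex removed.\<close>
definition solid_cap :: "real^3 \<Rightarrow> real \<Rightarrow> (real^3) set" where
  "solid_cap x T = {p \<in> cball 0 1. 0 < x \<bullet> p \<and> (norm p)\<^sup>2 \<le> (1 + T\<^sup>2) * (x \<bullet> p)\<^sup>2}"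

text \<open>By Bessel's inequality, \<open>(x \<bullet> p)\<^sup>2 + (w \<bullet> p)\<^sup>2 \<le> (norm p)\<^sup>2\<close>, so the circle bounding the wedge cuts nothing off the cap.\<close>
lemma solid_cap_eq_cap_wedge:
  assumes "norm x = 1" "norm w = 1" "x \<bullet> w = 0" "0 < T"
  shows "solid_cap x T = cap_wedge x w (- T) T"
proof -
  have "- T * (x \<bullet> p) \<le> w \<bullet> p" if "0 < x \<bullet> p" "(norm p)\<^sup>2 \<le> (1 + T\<^sup>2) * (x \<bullet> p)\<^sup>2" for p
  proof -
    define r where "r = p - (x \<bullet> p) *\<^sub>R x - (w \<bullet> p) *\<^sub>R w"
    have ip: "x \<bullet> x = 1" "w \<bullet> w = 1" "w \<bullet> x = 0" using assms by (auto simp: norm_eq_1 inner_commute)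
    have "r \<bullet> r = p \<bullet> p - (x \<bullet> p)\<^sup>2 - (w \<bullet> p)\<^sup>2"
      by (simp add: r_def inner_diff_left inner_diff_right ip assms(3) power2_eq_square inner_commute[of p x] inner_commute[of p w])
    then have "(x \<bullet> p)\<^sup>2 + (w \<bullet> p)\<^sup>2 \<le> (norm p)\<^sup>2"
      using inner_ge_zero[of r] by (simp add: power2_norm_eq_inner)
    then have "(w \<bullet> p)\<^sup>2 \<le> (T * (x \<bullet> p))\<^sup>2" using that(2) by (simp add: power_mult_distrib algebra_simps)
    then have "\<bar>w \<bullet> p\<bar> \<le> T * (x \<bullet> p)" using that(1) assms(4) by (simp add: abs_le_square_iff[symmetric])
    then show ?thesis by linarith
  qed
  then show ?thesis unfolding solid_cap_def cap_wedge_def by auto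
qed

lemma unit_normal_exists:
  fixes x :: "real^3"
  obtains w where "norm w = 1" "x \<bullet> w = 0"
proof -
  obtain y where y: "y \<noteq> 0" "orthogonal x y"
    by (rule orthogonal_to_vector_exists[of x]) auto
  show thesis by (rule that[of "y /\<^sub>R norm y"]) (use y in \<open>auto simp: orthogonal_def\<close>)
qed

lemma cap_wedge_lmeasurable: "cap_wedge x w t T \<in> lmeasurable"
  by (intro bounded_lmeasurable cap_wedge_borel) (auto simp: cap_wedge_def)

section \<open>The volume bound for a totally separable packing\<close>

text \<open>
  The cell covers the larger cap of radius \<open>arctan T\<close> except for what its sides cut off. A side at
  distance at least \<open>\<rho>\<^sub>0\<close> from the center, where \<open>c = cos \<rho>\<^sub>0\<close>, cuts off a subset of the segment
  beyond the circle at distance exactly \<open>\<rho>\<^sub>0\<close>.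
\<close>
lemma volume_cell_single_cap:
  fixes x :: "real^3"
  assumes x: "norm x = 1" and "finite N" and c: "0 < c" "c < 1"
    and N: "\<And>u. u \<in> N \<Longrightarrow> norm u = 1 \<and> sqrt (1 - c\<^sup>2) \<le> u \<bullet> x"
    and \<phi>: "0 < \<phi>" "\<phi> < pi / 2"
  defines "q \<equiv> c * cos \<phi> / sqrt (1 - (c * sin \<phi>)\<^sup>2)"
  shows "2 * pi / 3 * (1 - q) - card N * (2 / 3 * (arcsin (c * sin \<phi>) - q * \<phi>))
    \<le> measure lebesgue (open_cell N)"
proof -
  define s where "s = sqrt (1 - c\<^sup>2)"
  define t where "t = s / c"
  define T where "T = t / cos \<phi>"
  have c2: "c\<^sup>2 < 1" using c by (simp add: power_less_one_iff)
  then have s: "0 < s" "s\<^sup>2 = 1 - c\<^sup>2" by (simp_all add: s_def)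
  have T: "0 < T" using s c \<phi> cos_gt_zero[of \<phi>] by (simp add: T_def t_def)
  define cut where "cut u = solid_cap x T \<inter> {p. u \<bullet> p \<le> 0}" for u
  obtain w0 where w0: "norm w0 = 1" "x \<bullet> w0 = 0" by (rule unit_normal_exists)
  have solid: "solid_cap x T = cap_wedge x w0 (- T) T" by (rule solid_cap_eq_cap_wedge[OF x w0 T])
  have cap_meas: "solid_cap x T \<in> lmeasurable"
    unfolding solid by (rule cap_wedge_lmeasurable)
  have cap_vol: "measure lebesgue (solid_cap x T) = 2 * pi / 3 * (1 - q)"
    unfolding solid unfolding q_def T_def t_def s_def
    by (rule volume_cap_wedge_closed_form(2)[OF x w0 c \<phi>])
  have cut_meas: "cut u \<in> lmeasurable" for u
    unfolding cut_def using cap_meas by (intro fmeasurable_Int_fmeasurable) (simp_all add: closed_halfspace_le borel_closed)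
  have wedge: "measure lebesgue (cap_wedge x w t T) = 2 / 3 * (arcsin (c * sin \<phi>) - q * \<phi>)"
    if "norm w = 1" "x \<bullet> w = 0" for w
    unfolding q_def T_def t_def s_def by (rule volume_cap_wedge_closed_form(1)[OF x that c \<phi>])
  have cut_le: "measure lebesgue (cut u) \<le> 2 / 3 * (arcsin (c * sin \<phi>) - q * \<phi>)" if u: "u \<in> N" for u
  proof -
    obtain w where w: "norm w = 1" "x \<bullet> w = 0" and sub: "cut u \<subseteq> cap_wedge x w t T"
    proof (cases "u = x")
      case True
      then have "cut u = {}" by (auto simp: cut_def solid_cap_def)
      then show thesis using that[OF w0] by blast
    next
      case False
      \<comment> \<open>up to normalization, the direction in the tangent plane at \<open>x\<close> that leads to the circle\<close>
      define y where "y = (u \<bullet> x) *\<^sub>R x - u"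
      have ip: "x \<bullet> x = 1" "u \<bullet> u = 1" using x N[OF u] by (auto simp: norm_eq_1)
      have "u \<bullet> x < 1"
        using norm_cauchy_schwarz_eq[of u x] norm_cauchy_schwarz[of u x] N[OF u] x False by auto
      have ux: "s \<le> u \<bullet> x" using N[OF u] by (simp add: s_def)
      have ny: "(norm y)\<^sup>2 = 1 - (u \<bullet> x)\<^sup>2"
        unfolding power2_norm_eq_inner
        by (simp add: y_def inner_diff_left inner_diff_right ip inner_commute[of x u] power2_eq_square)
      have "(u \<bullet> x)\<^sup>2 < 1" using \<open>u \<bullet> x < 1\<close> ux s by (simp add: power_less_one_iff)
      then have "0 < norm y" using ny by (metis diff_gt_0_iff_gt norm_ge_zero order_le_less power_zero_numeral)
      have "s\<^sup>2 \<le> (u \<bullet> x)\<^sup>2" using ux s by (intro power_mono) auto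
      then have "(norm y)\<^sup>2 \<le> c\<^sup>2" using ny s by simp
      then have yc: "norm y \<le> c" using c by (simp add: abs_le_square_iff[symmetric])
      show thesis
      proof (rule that[of "y /\<^sub>R norm y"])
        show "norm (y /\<^sub>R norm y) = 1" using \<open>0 < norm y\<close> by simp
        show "x \<bullet> (y /\<^sub>R norm y) = 0" by (simp add: y_def inner_diff_right ip inner_commute)
        have "t * (x \<bullet> p) \<le> (y /\<^sub>R norm y) \<bullet> p" if p: "0 < x \<bullet> p" "u \<bullet> p \<le> 0" for p
        proof -
          have "s * (x \<bullet> p) \<le> (u \<bullet> x) * (x \<bullet> p)" using ux p by simp
          also have "\<dots> \<le> y \<bullet> p" using p by (simp add: y_def inner_diff_left)
          finally have 1: "s * (x \<bullet> p) \<le> y \<bullet> p" .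
          then have "0 \<le> y \<bullet> p" using s p by (smt (verit) mult_pos_pos)
          then have "(y \<bullet> p) / c \<le> (y \<bullet> p) / norm y"
            using yc \<open>0 < norm y\<close> c by (intro divide_left_mono) auto
          moreover have "t * (x \<bullet> p) \<le> (y \<bullet> p) / c" using 1 c by (simp add: t_def field_simps)
          ultimately show ?thesis by (simp add: divide_inverse mult.commute)
        qed
        then show "cut u \<subseteq> cap_wedge x (y /\<^sub>R norm y) t T"
          unfolding cut_def solid_cap_def cap_wedge_def by blast
      qed
    qed
    have "measure lebesgue (cut u) \<le> measure lebesgue (cap_wedge x w t T)"
      by (intro measure_mono_fmeasurable sub fmeasurableD cut_meas cap_wedge_lmeasurable)
    then show ?thesis by (simp add: wedge[OF w])
  qed
  have "measure lebesgue (solid_cap x T) \<le> measure lebesgue (open_cell N \<union> (\<Union>u\<in>N. cut u))"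
  proof (rule measure_mono_fmeasurable)
    show "solid_cap x T \<subseteq> open_cell N \<union> (\<Union>u\<in>N. cut u)"
      by (auto simp: open_cell_def cut_def solid_cap_def not_less)
  qed (use cap_meas cut_meas open_cell_lmeasurable \<open>finite N\<close> in \<open>auto intro!: fmeasurable.Un fmeasurable.finite_UN\<close>)
  also have "\<dots> \<le> measure lebesgue (open_cell N) + measure lebesgue (\<Union>u\<in>N. cut u)"
    by (intro measure_Un_le fmeasurableD open_cell_lmeasurable \<open>finite N\<close> fmeasurable.finite_UN cut_meas)
  also have "measure lebesgue (\<Union>u\<in>N. cut u) \<le> (\<Sum>u\<in>N. measure lebesgue (cut u))"
    by (intro measure_UNION_le \<open>finite N\<close> fmeasurableD cut_meas)
  also have "\<dots> \<le> (\<Sum>u\<in>N. 2 / 3 * (arcsin (c * sin \<phi>) - q * \<phi>))"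
    by (intro sum_mono cut_le)
  finally show ?thesis using cap_vol by simp
qed

text \<open>Otherwise the point of the circle nearest to \<open>x\<close> would be an interior point of the cap.\<close>
lemma ts_circle_distance:
  assumes "norm u = 1" "norm x = 1" and r: "0 < r" "r \<le> pi / 2"
    and disjoint: "great_circle u \<inter> (top_of_set S2 interior_of cap x r) = {}"
  shows "sin r \<le> \<bar>u \<bullet> x\<bar>"
proof (rule ccontr)
  assume "\<not> ?thesis"
  then have lt: "\<bar>u \<bullet> x\<bar> < sin r" by simp
  have ip: "x \<bullet> x = 1" "u \<bullet> u = 1" using assms by (auto simp: norm_eq_1)
  have sin: "0 < sin r" "0 \<le> cos r" using r by (auto intro: sin_gt_zero cos_ge_zero)
  define y where "y = x - (u \<bullet> x) *\<^sub>R u"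
  have "\<bar>u \<bullet> x\<bar>\<^sup>2 < (sin r)\<^sup>2" using lt by (intro power_strict_mono) auto
  then have ux: "(cos r)\<^sup>2 < 1 - (u \<bullet> x)\<^sup>2" by (simp add: cos_squared_eq)
  have uy: "u \<bullet> y = 0" by (simp add: y_def inner_diff_right ip)
  have yx: "y \<bullet> x = 1 - (u \<bullet> x)\<^sup>2"
    by (simp add: y_def inner_diff_left ip power2_eq_square)
  have "(norm y)\<^sup>2 = y \<bullet> x"
    unfolding power2_norm_eq_inner by (subst (2) y_def) (simp add: inner_diff_right uy inner_commute[of y u])
  then have ny: "(norm y)\<^sup>2 = 1 - (u \<bullet> x)\<^sup>2" using yx by simp
  have "cos r < norm y" using ux ny by (intro power2_less_imp_less[of "cos r" "norm y"]) auto
  then have pos: "0 < norm y" using sin by linarith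
  define z where "z = y /\<^sub>R norm y"
  have "z \<bullet> x = (norm y)\<^sup>2 / norm y" using ny yx by (simp add: z_def divide_inverse)
  then have zx: "cos r < z \<bullet> x" using \<open>cos r < norm y\<close> pos by (simp add: power2_eq_square)
  have zS: "z \<in> S2" using pos by (simp add: z_def)
  have "openin (top_of_set S2) (S2 \<inter> {p. cos r < p \<bullet> x})"
    by (intro openin_open_Int open_Collect_less continuous_intros)
  moreover have "S2 \<inter> {p. cos r < p \<bullet> x} \<subseteq> cap x r" by (auto simp: cap_def)
  ultimately have "z \<in> top_of_set S2 interior_of cap x r"
    unfolding interior_of_def using zS zx by blast
  moreover have "z \<in> great_circle u" using zS uy by (simp add: great_circle_def z_def)
  ultimately show False using disjoint by blast
qed

lemma ts_packing_separation:
  assumes ts: "ts_packing I x (\<lambda>_. r)" and ij: "i \<in> I" "j \<in> I" "i \<noteq> j"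
  shows "\<exists>v. norm v = 1 \<and> sin r \<le> v \<bullet> x i \<and> v \<bullet> x j \<le> - sin r \<and> (\<forall>k\<in>I. sin r \<le> \<bar>v \<bullet> x k\<bar>)"
proof -
  have I: "norm (x k) = 1" "0 < r" "r \<le> pi / 2" if "k \<in> I" for k
    using ts that by (auto simp: ts_packing_def)
  obtain u where u: "u \<noteq> 0" "cap (x i) r \<subseteq> hemisphere u" "cap (x j) r \<subseteq> hemisphere (- u)"
    "\<forall>k\<in>I. great_circle u \<inter> (top_of_set S2 interior_of cap (x k) r) = {}"
    using ts ij unfolding ts_packing_def by blast
  define v where "v = u /\<^sub>R norm u"
  have v: "norm v = 1" using u(1) by (simp add: v_def)
  have "great_circle v = great_circle u" using u(1) by (auto simp: great_circle_def v_def)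
  then have dist: "sin r \<le> \<bar>v \<bullet> x k\<bar>" if "k \<in> I" for k
    using ts_circle_distance[OF v, of "x k" r] I[OF that] u(4) that by auto
  have center: "x k \<in> cap (x k) r" if "k \<in> I" for k
    using I[OF that] by (simp add: cap_def norm_eq_1)
  have "0 \<le> u \<bullet> x i" "u \<bullet> x j \<le> 0"
    using u(2,3) center[OF ij(1)] center[OF ij(2)] by (auto simp: hemisphere_def)
  then have "0 \<le> v \<bullet> x i" "v \<bullet> x j \<le> 0"
    using u(1) by (auto simp: v_def mult_nonneg_nonpos zero_le_mult_iff mult_le_0_iff)
  then show ?thesis using v dist dist[OF ij(1)] dist[OF ij(2)] by (intro exI[of _ v]) auto
qed

text \<open>
  Summation over the cells. The first cut is made separately: it produces two cells with a single
  side each, which gives \<open>4 m - 6\<close> sides in total, whereas the general step would allow more.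
  Since only \<open>cos r \<le> c\<close> is assumed, \<open>c\<close> may be chosen later, and caps of radius \<open>\<pi> / 2\<close> are included.
\<close>
lemma ts_packing_volume_bound:
  assumes ts: "ts_packing I x (\<lambda>_. r)" and card: "2 \<le> card I"
    and c: "0 < c" "c < 1" "cos r \<le> c" and \<phi>: "0 < \<phi>" "\<phi> < pi / 2"
  defines "q \<equiv> c * cos \<phi> / sqrt (1 - (c * sin \<phi>)\<^sup>2)"
  shows "2 * pi * card I * (1 - q) - (4 * real (card I) - 6) * (2 * (arcsin (c * sin \<phi>) - q * \<phi>)) \<le> 4 * pi"
proof -
  define A where "A = 2 * pi / 3 * (1 - q)"
  define B where "B = 2 / 3 * (arcsin (c * sin \<phi>) - q * \<phi>)"
  define s where "s = sqrt (1 - c\<^sup>2)"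
  have fin: "finite I" and I: "\<And>k. k \<in> I \<Longrightarrow> norm (x k) = 1" "\<And>k. k \<in> I \<Longrightarrow> 0 < r \<and> r \<le> pi / 2"
    using ts by (auto simp: ts_packing_def)
  obtain i j where ij: "i \<in> I" "j \<in> I" "i \<noteq> j"
    using card fin by (meson card_2_iff' ex_card subset_iff)
  have r: "0 < r" "r \<le> pi / 2" using I(2)[OF ij(1)] by auto
  have "c\<^sup>2 < 1" using c by (simp add: power_less_one_iff)
  then have "0 < s" by (simp add: s_def)
  have "s \<le> sin r"
  proof -
    have "(cos r)\<^sup>2 \<le> c\<^sup>2" using c r by (intro power_mono cos_ge_zero) auto
    then have "1 - c\<^sup>2 \<le> (sin r)\<^sup>2" by (simp add: cos_squared_eq)
    then show ?thesis unfolding s_def using r by (intro real_le_lsqrt) (auto intro: sin_ge_zero)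
  qed
  have sep: "\<exists>v. norm v = 1 \<and> s \<le> v \<bullet> x i \<and> v \<bullet> x j \<le> - s \<and> (\<forall>k\<in>I. s \<le> \<bar>v \<bullet> x k\<bar>)"
    if "i \<in> I" "j \<in> I" "i \<noteq> j" for i j
    using ts_packing_separation[OF ts that] \<open>s \<le> sin r\<close> by (meson neg_le_iff_le order_trans)
  obtain w where w: "norm w = 1" "x i \<bullet> w = 0" by (rule unit_normal_exists)
  have "0 \<le> B"
    using volume_cap_wedge_closed_form(1)[OF I(1)[OF ij(1)] w c(1,2) \<phi>]
    unfolding B_def q_def by (metis measure_nonneg)
  note cell_ge = volume_cell_ge[where I = I and x = x and A = A and s = s, OF \<open>0 \<le> B\<close> \<open>0 < s\<close> _ sep]
  have single: "A - card N * B \<le> measure lebesgue (open_cell N)"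
    if "k \<in> I" "finite N" "\<And>u. u \<in> N \<Longrightarrow> norm u = 1 \<and> s \<le> u \<bullet> x k" for k N
    unfolding A_def B_def q_def s_def
    by (rule volume_cell_single_cap[OF I(1)[OF that(1)] that(2) c(1,2) _ \<phi>]) (use that(3) in \<open>simp add: s_def\<close>)
  obtain v where v: "norm v = 1" "s \<le> v \<bullet> x i" "v \<bullet> x j \<le> - s" "\<And>k. k \<in> I \<Longrightarrow> s \<le> \<bar>v \<bullet> x k\<bar>"
    using sep[OF ij] by blast
  define I1 I2 where "I1 = {k \<in> I. 0 < v \<bullet> x k}" and "I2 = {k \<in> I. \<not> 0 < v \<bullet> x k}"
  have sub: "I1 \<subseteq> I" "I2 \<subseteq> I" "finite I1" "finite I2" "i \<in> I1" "j \<in> I2"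
    using fin ij v \<open>0 < s\<close> by (auto simp: I1_def I2_def)
  have "I1 \<union> I2 = I" "I1 \<inter> I2 = {}" by (auto simp: I1_def I2_def)
  then have sum: "real (card I1) + real (card I2) = real (card I)"
    using card_Un_disjoint[OF sub(3,4)] by simp
  have "card I1 * A - (card {v} + 4 * real (card I1) - 4) * B \<le> measure lebesgue (open_cell {v})"
    by (rule cell_ge[OF single])
      (use sub v v(4) in \<open>fastforce simp: I1_def\<close>)+
  moreover have "card I2 * A - (card {-v} + 4 * real (card I2) - 4) * B \<le> measure lebesgue (open_cell {-v})"
    by (rule cell_ge[OF single])
      (use sub v v(4) in \<open>fastforce simp: I2_def\<close>)+
  moreover have "measure lebesgue (open_cell {v}) + measure lebesgue (open_cell {-v}) \<le> measure lebesgue (open_cell {})"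
    using volume_cell_cut[of "{}" v] by simp
  moreover have "open_cell {} = cball 0 1" by (auto simp: open_cell_def)
  then have "measure lebesgue (open_cell {}) = 4 / 3 * pi"
    by (simp add: content_cball unit_ball_vol_3)
  moreover have "card I1 * A - (card {v} + 4 * real (card I1) - 4) * B + (card I2 * A - (card {-v} + 4 * real (card I2) - 4) * B)
     = card I * A - (4 * real (card I) - 6) * B"
    unfolding sum[symmetric] by (simp add: algebra_simps)
  ultimately have total: "card I * A - (4 * real (card I) - 6) * B \<le> 4 / 3 * pi" by linarith
  have "2 * pi * card I * (1 - q) - (4 * real (card I) - 6) * (2 * (arcsin (c * sin \<phi>) - q * \<phi>))
     = 3 * (card I * A - (4 * real (card I) - 6) * B)"
    by (simp add: A_def B_def field_simps)
  also have "\<dots> \<le> 3 * (4 / 3 * pi)" using total by (intro mult_left_mono) auto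
  finally show ?thesis by simp
qed

text \<open>
  The choice \<open>\<phi> = \<pi> m / (4 m - 6)\<close> removes the terms containing \<open>cos R\<close>. For \<open>m = 3\<close> it equals
  \<open>\<pi> / 2\<close>, where the cap of radius \<open>R\<close> is a hemisphere and has no gnomonic image; the bound is
  extended to this endpoint by continuity.
\<close>
lemma ts_packing_angle_bound:
  assumes ts: "ts_packing I x (\<lambda>_. r)" and card: "3 \<le> card I"
    and c: "0 < c" "c < 1" "cos r \<le> c"
  defines "s \<equiv> pi / (4 * real (card I) - 6)"
  shows "sin (pi / 4 - s / 2) \<le> c * sin (pi / 4 + 3 / 2 * s)"
proof -
  define m where "m = real (card I)"
  have m: "3 \<le> m" using card by (simp add: m_def)
  define g where "g \<phi> = 2 * pi * m * (1 - c * cos \<phi> / sqrt (1 - (c * sin \<phi>)\<^sup>2))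
     - (4 * m - 6) * (2 * (arcsin (c * sin \<phi>) - c * cos \<phi> / sqrt (1 - (c * sin \<phi>)\<^sup>2) * \<phi>))" for \<phi>
  have c_sin: "\<bar>c * sin \<phi>\<bar> < 1" for \<phi>
  proof -
    have "\<bar>c * sin \<phi>\<bar> \<le> c" using c mult_left_mono[of "\<bar>sin \<phi>\<bar>" 1 c] by (simp add: abs_mult)
    then show ?thesis using c by linarith
  qed
  have root_pos: "0 < 1 - (c * sin \<phi>)\<^sup>2" for \<phi>
    using c_sin[of \<phi>] by (simp add: abs_square_less_1)
  have cont: "isCont g \<phi>" for \<phi>
    unfolding g_def using c_sin[of \<phi>] root_pos[of \<phi>]
    by (intro continuous_intros isCont_arcsin[THEN isCont_o2[rotated]]) (auto simp: abs_less_iff)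
  have open_bound: "g \<phi> \<le> 4 * pi" if "0 < \<phi>" "\<phi> < pi / 2" for \<phi>
    using ts_packing_volume_bound[OF ts _ c that] card by (simp add: g_def m_def)
  have "g (pi / 2) \<le> 4 * pi"
  proof (rule tendsto_upperbound)
    show "(g \<longlongrightarrow> g (pi / 2)) (at_left (pi / 2))"
      using cont[of "pi / 2"] by (simp add: continuous_within filterlim_at_split)
    show "eventually (\<lambda>\<phi>. g \<phi> \<le> 4 * pi) (at_left (pi / 2))"
      by (rule eventually_mono[OF eventually_at_left_real[of 0 "pi / 2"]]) (auto intro: open_bound)
  qed simp
  then have bound: "g \<phi> \<le> 4 * pi" if "0 < \<phi>" "\<phi> \<le> pi / 2" for \<phi>
    using open_bound[of \<phi>] that by (metis order_le_less)
  have s: "(4 * m - 6) * s = pi" "0 < s" "s \<le> pi / 6"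
    using m by (auto simp: s_def m_def[symmetric] field_simps)
  define \<phi> where "\<phi> = m * s"
  have \<phi>: "\<phi> = pi / 4 + 3 / 2 * s" using s(1) by (simp add: \<phi>_def algebra_simps)
  have range: "0 < \<phi>" "\<phi> \<le> pi / 2" using s by (simp_all add: \<phi>)
  have "g \<phi> = 2 * pi * m - 2 * (4 * m - 6) * arcsin (c * sin \<phi>)"
  proof -
    have "(4 * m - 6) * \<phi> = pi * m" using s(1) by (simp add: \<phi>_def mult.assoc[symmetric] mult.commute)
    moreover define Q where "Q = c * cos \<phi> / sqrt (1 - (c * sin \<phi>)\<^sup>2)"
    have "g \<phi> = 2 * pi * m * (1 - Q) - 2 * (4 * m - 6) * arcsin (c * sin \<phi>) + 2 * Q * ((4 * m - 6) * \<phi>)"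
      unfolding g_def Q_def[symmetric] by (simp add: algebra_simps)
    ultimately show ?thesis by (simp add: algebra_simps)
  qed
  then have "(m - 2) * pi \<le> (4 * m - 6) * arcsin (c * sin \<phi>)"
    using bound[OF range] by (simp add: algebra_simps)
  moreover have "(m - 2) * pi = (4 * m - 6) * (pi / 4 - s / 2)"
  proof -
    have "(4 * m - 6) * (pi / 4 - s / 2) = (4 * m - 6) * pi / 4 - (4 * m - 6) * s / 2"
      by (simp add: right_diff_distrib)
    then show ?thesis unfolding s(1) by (simp add: field_simps)
  qed
  ultimately have "pi / 4 - s / 2 \<le> arcsin (c * sin \<phi>)"
    using m by simp
  then have "sin (pi / 4 - s / 2) \<le> sin (arcsin (c * sin \<phi>))"
    using s arcsin_bounded[of "c * sin \<phi>"] c_sin[of \<phi>]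
    by (intro sin_monotone_2pi_le) (auto simp: abs_less_iff)
  also have "\<dots> = c * sin \<phi>" using c_sin[of \<phi>] by (intro sin_arcsin) (auto simp: abs_less_iff)
  finally show ?thesis by (simp add: \<phi>)
qed

section \<open>The trigonometric inequality\<close>

text \<open>On this interval \<open>cos\<close> is concave, and the left-hand side is its chord.\<close>
lemma cos_ge_chord:
  assumes "pi / 3 \<le> w" "w \<le> pi / 2"
  shows "3 / 2 - 3 * w / pi \<le> cos w"
proof -
  have concave: "concave_on {0..pi / 2} cos"
    unfolding concave_on_def
  proof (rule f''_ge0_imp_convex)
    show "((\<lambda>x. - cos x) has_real_derivative sin x) (at x)" for x :: real
      by (auto intro!: derivative_eq_intros)
    show "(sin has_real_derivative cos x) (at x)" for x :: real
      by (auto intro!: derivative_eq_intros)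
  qed (auto intro: cos_ge_zero)
  define t where "t = 6 * w / pi - 2"
  have t: "0 \<le> t" "t \<le> 1" using assms by (auto simp: t_def field_simps)
  have "(1 - t) * cos (pi / 3) + t * cos (pi / 2) \<le> cos ((1 - t) *\<^sub>R (pi / 3) + t *\<^sub>R (pi / 2))"
    using concave_onD[OF concave t, of "pi / 3" "pi / 2"] by simp
  also have "(1 - t) *\<^sub>R (pi / 3) + t *\<^sub>R (pi / 2) = w" by (simp add: t_def field_simps)
  finally show ?thesis by (simp add: cos_60 t_def)
qed

text \<open>
  With \<open>\<theta> = \<pi> / 4 - s / 2\<close> the left-hand sine is \<open>sin (3 \<theta>)\<close> and \<open>sin s = cos (2 \<theta>)\<close>. Hence
  \<open>sin (3 \<theta>) - sin \<theta> = 2 sin s sin \<theta> < 2 s sin \<theta>\<close>, and it remains to see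
  \<open>(\<pi> + 6 s) sin \<theta> \<le> \<pi> sin (3 \<theta>)\<close>. Division by \<open>sin \<theta>\<close> turns this into the chord inequality for
  \<open>cos\<close> at \<open>2 \<theta>\<close>.
\<close>
lemma density_threshold:
  assumes "0 < s" "s \<le> pi / 6"
  shows "(1 - 2 * pi * s / (pi + 6 * s)) * sin (pi / 4 + 3 / 2 * s) < sin (pi / 4 - s / 2)"
proof -
  define \<theta> where "\<theta> = pi / 4 - s / 2"
  have s: "s = pi / 2 - 2 * \<theta>" by (simp add: \<theta>_def)
  have \<theta>: "pi / 6 \<le> \<theta>" "\<theta> < pi / 4" using assms by (auto simp: \<theta>_def)
  have sin_pos: "0 < sin \<theta>" using \<theta> by (intro sin_gt_zero) auto
  have "sin (pi / 4 + 3 / 2 * s) = sin (pi - 3 * \<theta>)"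
    by (rule arg_cong[where f = sin]) (simp add: s algebra_simps)
  then have sin3: "sin (pi / 4 + 3 / 2 * s) = sin (3 * \<theta>)" by simp
  have triple: "sin (3 * \<theta>) = (1 + 2 * cos (2 * \<theta>)) * sin \<theta>"
  proof -
    have half: "2 * (cos \<theta>)\<^sup>2 = 1 + cos (2 * \<theta>)" by (simp add: cos_double_cos)
    have "sin (3 * \<theta>) = sin (2 * \<theta> + \<theta>)" by (rule arg_cong[where f = sin]) simp
    also have "\<dots> = sin \<theta> * (2 * (cos \<theta>)\<^sup>2) + cos (2 * \<theta>) * sin \<theta>"
      unfolding sin_add sin_double power2_eq_square by (simp add: algebra_simps)
    also have "\<dots> = (1 + 2 * cos (2 * \<theta>)) * sin \<theta>" unfolding half by (simp add: algebra_simps)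
    finally show ?thesis .
  qed
  have "3 * pi - 12 * \<theta> \<le> 2 * pi * cos (2 * \<theta>)"
    using cos_ge_chord[of "2 * \<theta>"] \<theta> by (simp add: field_simps)
  then have "(pi + 6 * s) * sin \<theta> \<le> pi * (1 + 2 * cos (2 * \<theta>)) * sin \<theta>"
    using sin_pos by (intro mult_right_mono) (simp_all add: s algebra_simps)
  then have chord: "(pi + 6 * s) * sin \<theta> \<le> pi * sin (3 * \<theta>)" by (simp add: triple mult.assoc)
  have sin_less_arg: "sin s < s"
  proof -
    have "cos (s / 2) < 1" "0 < sin (s / 2)"
      using assms cos_monotone_0_pi[of 0 "s / 2"] by (auto intro: sin_gt_zero)
    then have "2 * sin (s / 2) * cos (s / 2) < 2 * sin (s / 2)" by simp
    also have "\<dots> \<le> s" using sin_x_le_x[of "s / 2"] assms by simp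
    finally show ?thesis using sin_double[of "s / 2"] by simp
  qed
  have "sin (3 * \<theta>) - sin \<theta> = 2 * sin s * sin \<theta>"
  proof -
    have "cos (2 * \<theta>) = sin s" by (simp add: s sin_diff)
    then show ?thesis unfolding triple by (simp add: algebra_simps)
  qed
  then have "(pi + 6 * s) * (sin (3 * \<theta>) - sin \<theta>) = 2 * sin s * ((pi + 6 * s) * sin \<theta>)" by simp
  also have "\<dots> < 2 * s * ((pi + 6 * s) * sin \<theta>)"
    using sin_less_arg assms sin_pos by (intro mult_strict_right_mono mult_pos_pos) auto
  also have "\<dots> \<le> 2 * s * (pi * sin (3 * \<theta>))"
    using chord assms by (intro mult_left_mono) auto
  also have "\<dots> = 2 * pi * s * sin (3 * \<theta>)" by simp
  finally have "(pi + 6 * s) * (sin (3 * \<theta>) - sin \<theta>) < 2 * pi * s * sin (3 * \<theta>)" .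
  moreover have pos: "0 < pi + 6 * s" using assms by (simp add: add_pos_pos)
  ultimately have "sin (3 * \<theta>) - sin \<theta> < 2 * pi * s / (pi + 6 * s) * sin (3 * \<theta>)"
    by (simp add: field_simps)
  then show ?thesis unfolding sin3 by (simp add: \<theta>_def[symmetric] left_diff_distrib)
qed

section \<open>Areas of caps and the density\<close>

lemma spherical_area_cap:
  assumes "norm x = 1" "0 < r" "r < pi / 2"
  shows "spherical_area (cap x r) = 2 * pi * (1 - cos r)"
proof -
  define T where "T = tan r"
  have cosr: "0 < cos r" using assms by (intro cos_gt_zero) auto
  have T: "0 < T" using assms by (simp add: T_def tan_gt_zero)
  have sec: "1 + T\<^sup>2 = (1 / cos r)\<^sup>2"
    using tan_sec[of r] cosr by (simp add: T_def divide_inverse)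
  have cone: "{t *\<^sub>R y | t y. 0 \<le> t \<and> t \<le> 1 \<and> y \<in> cap x r} = insert 0 (solid_cap x T)"
  proof (intro equalityI subsetI)
    fix p assume "p \<in> {t *\<^sub>R y | t y. 0 \<le> t \<and> t \<le> 1 \<and> y \<in> cap x r}"
    then obtain t y where p: "p = t *\<^sub>R y" "0 \<le> t" "t \<le> 1" and y: "norm y = 1" "cos r \<le> y \<bullet> x"
      by (auto simp: cap_def)
    show "p \<in> insert 0 (solid_cap x T)"
    proof (cases "t = 0")
      case False
      have "1 \<le> (y \<bullet> x) / cos r" using y cosr by simp
      then have "1 \<le> ((y \<bullet> x) / cos r)\<^sup>2" by (simp add: one_le_power)
      then have "t\<^sup>2 * 1 \<le> t\<^sup>2 * ((y \<bullet> x) / cos r)\<^sup>2" by (intro mult_left_mono) auto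
      then show ?thesis
        using p y False cosr unfolding solid_cap_def sec
        by (auto simp: inner_commute[of x y] power_mult_distrib power_divide mult_ac)
    qed (simp add: p)
  next
    fix p assume p: "p \<in> insert 0 (solid_cap x T)"
    show "p \<in> {t *\<^sub>R y | t y. 0 \<le> t \<and> t \<le> 1 \<and> y \<in> cap x r}"
    proof (cases "p = 0")
      case True
      have "x \<in> cap x r" using assms by (simp add: cap_def norm_eq_1)
      then show ?thesis using True by (auto intro!: exI[of _ 0] exI[of _ x])
    next
      case False
      with p have p: "norm p \<le> 1" "0 < x \<bullet> p" "(norm p)\<^sup>2 \<le> ((x \<bullet> p) / cos r)\<^sup>2"
        unfolding solid_cap_def sec by (auto simp: power_divide)
      have "norm p \<le> (x \<bullet> p) / cos r"
        using p(2,3) cosr by (intro power2_le_imp_le[OF p(3)]) auto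
      then have "cos r \<le> (p /\<^sub>R norm p) \<bullet> x"
        using False cosr by (simp add: field_simps inner_commute)
      then have "p /\<^sub>R norm p \<in> cap x r" using False by (simp add: cap_def)
      moreover have "p = norm p *\<^sub>R (p /\<^sub>R norm p)" using False by simp
      ultimately show ?thesis using p(1) by (metis (mono_tags, lifting) mem_Collect_eq norm_ge_zero)
    qed
  qed
  obtain w where w: "norm w = 1" "x \<bullet> w = 0" by (rule unit_normal_exists)
  have solid: "solid_cap x T = cap_wedge x w (- T) T" by (rule solid_cap_eq_cap_wedge[OF assms(1) w T])
  have "measure lebesgue (insert 0 (solid_cap x T)) = measure lebesgue (solid_cap x T)"
    by (rule measure_negligible_symdiff) (auto simp: solid cap_wedge_lmeasurable fmeasurableD intro: negligible_subset[of "{0}"])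
  also have "\<dots> = 2 / (3 * sqrt (1 + T\<^sup>2)) * (segment_primitive T T - segment_primitive T (- T))"
    unfolding solid using T by (intro volume_cap_wedge assms(1) w) auto
  also have "\<dots> = 2 / (3 * (1 / cos r)) * ((1 / cos r - 1) * pi)"
  proof -
    have "sqrt (1 + T\<^sup>2) = 1 / cos r" using cosr by (simp add: sec)
    then show ?thesis unfolding segment_primitive_ends[OF T] by (simp add: algebra_simps)
  qed
  also have "\<dots> = 2 * pi / 3 * (1 - cos r)" using cosr by (simp add: field_simps)
  finally show ?thesis by (simp add: spherical_area_def cone)
qed

lemma spherical_area_S2: "spherical_area S2 = 4 * pi"
proof -
  have "{t *\<^sub>R y | t y. 0 \<le> t \<and> t \<le> 1 \<and> y \<in> S2} = cball 0 1"
  proof (intro equalityI subsetI)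
    fix p :: "real^3" assume p: "p \<in> cball 0 1"
    show "p \<in> {t *\<^sub>R y | t y. 0 \<le> t \<and> t \<le> 1 \<and> y \<in> S2}"
    proof (cases "p = 0")
      case True
      then show ?thesis by (auto intro!: exI[of _ 0] exI[of _ "axis 1 1"] simp: norm_axis_1)
    next
      case False
      then have "p = norm p *\<^sub>R (p /\<^sub>R norm p)" "p /\<^sub>R norm p \<in> S2" by simp_all
      then show ?thesis using p by (metis (mono_tags, lifting) mem_Collect_eq norm_ge_zero mem_cball_0)
    qed
  qed auto
  then show ?thesis by (simp add: spherical_area_def content_cball unit_ball_vol_3)
qed

theorem corollary1:
  fixes I :: "'i set" and x :: "'i \<Rightarrow> real^3" and \<rho> :: real
  assumes "ts_packing I x (\<lambda>_. \<rho>)"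
    and "card I \<ge> 3"
  shows "packing_density I x (\<lambda>_. \<rho>) < pi / 4"
proof -
  define m where "m = real (card I)"
  define c where "c = 1 - pi / (2 * m)"
  define s where "s = pi / (4 * m - 6)"
  have m: "3 \<le> m" using assms(2) by (simp add: m_def)
  have c: "0 < c" "c < 1" using m pi_less_4 by (auto simp: c_def field_simps)
  have s: "0 < s" "s \<le> pi / 6" using m by (auto simp: s_def field_simps)
  \<comment> \<open>\<open>c\<close> is the cosine of the radius at which \<open>m\<close> caps have density \<open>\<pi> / 4\<close>\<close>
  have "c = 1 - 2 * pi * s / (pi + 6 * s)"
  proof -
    have "pi + 6 * s = 4 * m * s" using m by (simp add: s_def field_simps)
    then show ?thesis using s(1) m by (simp add: c_def)
  qed
  then have "c * sin (pi / 4 + 3 / 2 * s) < sin (pi / 4 - s / 2)"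
    using density_threshold[OF s] by simp
  then have "c < cos \<rho>"
    using ts_packing_angle_bound[OF assms c] by (fastforce simp: s_def m_def)
  have I: "norm (x i) = 1" "0 < \<rho>" "\<rho> \<le> pi / 2" if "i \<in> I" for i
    using assms(1) that by (auto simp: ts_packing_def)
  obtain i where "i \<in> I" using assms(2) by (metis all_not_in_conv card.empty not_numeral_le_zero)
  moreover have "\<rho> \<noteq> pi / 2" using \<open>c < cos \<rho>\<close> c(1) by (metis cos_pi_half less_asym)
  ultimately have \<rho>: "0 < \<rho>" "\<rho> < pi / 2" using I(2,3) by (auto simp: order_le_less)
  have "packing_density I x (\<lambda>_. \<rho>) = m * (1 - cos \<rho>) / 2"
    using I(1) \<rho> by (simp add: packing_density_def spherical_area_S2 spherical_area_cap m_def)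
  also have "\<dots> < m * (1 - c) / 2" using \<open>c < cos \<rho>\<close> m by simp
  also have "\<dots> = pi / 4" using m by (simp add: c_def)
  finally show ?thesis .
qed

end
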